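(* Let $c\in\mathbb{C}$, $c\neq0$, and let $n\geq2$, $m\geq2$ be integers with $m+n\geq5$. Then the equation $$f^n(z)+f^m(z+c)=1$$ admits a nonconstant meromorphic solution $f$ on $\mathbb{C}$ if and only if $n=m=3$.
   Context: Meromorphic functions are on the whole complex plane $\mathbb{C}$; $f^n(z)$ means $(f(z))^n$. *)

theory Defs
  imports "HOL-Complex_Analysis.Complex_Analysis"
begin

(* A meromorphic function on the plane is represented by its normal form
   (f nicely_meromorphic_on UNIV): removable singularities are removed and the value at each
   pole is the dummy value 0.  An identity between meromorphic functions is therefore required
   exactly at the points where none of the functions involved has a pole. *)
definition fermat_shift_solution ::
    "nat \<Rightarrow> nat \<Rightarrow> complex \<Rightarrow> (complex \<Rightarrow> complex) \<Rightarrow> bool" where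
  "fermat_shift_solution n m c f \<longleftrightarrow>
     f nicely_meromorphic_on UNIV \<and>
     (\<forall>z. \<not> is_pole f z \<longrightarrow> \<not> is_pole f (z + c) \<longrightarrow> f z ^ n + f (z + c) ^ m = 1)"

end

theory Submission
  imports Defs
begin

text \<open>
  Write \<open>g(z) = f(z + c)\<close>, so that \<open>(f, g)\<close> is a meromorphic map of the plane into the curve
  \<open>x^n + y^m = 1\<close>.

  \<^emph>\<open>Unequal exponents.\<close> At a pole of \<open>f\<close> the two powers must cancel, so \<open>g\<close> has a pole there too and the
  pole orders satisfy \<open>n * ord f z = m * ord f (z + c)\<close>.  If \<open>n \<noteq> m\<close>, walking along \<open>z + k c\<close> in the
  direction in which the orders shrink is an infinite descent, so \<open>f\<close> is entire
  (\<open>unequal_exponents_no_poles\<close>).  For entire \<open>f, g\<close> the factors \<open>1 - \<eta>^j g\<close> of \<open>1 - g^m = f^n\<close> are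
  pairwise coprime, hence \<open>n\<close>-th powers \<open>h_j^n\<close> of entire functions.  The linear relations between these
  powers produce an entire function that omits two values; little Picard makes it constant
  (\<open>entire_fermat_equation_trivial\<close>).

  \<^emph>\<open>Equal exponents at least 4.\<close> Poles are now allowed, so \<open>(f, g)\<close> maps into the compact curve, of genus at least 3,
  and no omitted values are available.  Instead, pull a metric of negative curvature back to the plane and use the Ahlfors-Schwarz
  argument.  With \<open>f = X/Z\<close>, \<open>g = Y/Z\<close> for entire \<open>X, Y, Z\<close> without common zeros, the Wronskians of
  \<open>X, Y, Z\<close> are \<open>w Y^(n-1)\<close>, \<open>w Z^(n-1)\<close>, \<open>- w X^(n-1)\<close> for one entire \<open>w\<close>, which comes from a holomorphic
  differential on the curve.  The metric \<open>\<rho> = |w|^2 (|X|^2 + |Y|^2 + |Z|^2)^(n-3)\<close> satisfies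
  \<open>\<Delta> log \<rho> \<ge> \<kappa> \<rho>\<close>, and this forces \<open>\<rho> = 0\<close>
  (\<open>negatively_curved_metric_vanishes\<close>, \<open>entire_fermat_curve_trivial\<close>).

  \<^emph>\<open>Exponents 3 and 3.\<close> The elliptic curve \<open>x^3 + y^3 = 1\<close> is parametrized by meromorphic functions
  \<open>x = P(u)\<close>, \<open>y = P(- u)\<close>, where \<open>u = 0\<close> is a flex at infinity: there negation in the group law exchanges
  the coordinates.  Since \<open>exp (\<pi> \<i> z / c)\<close> changes sign under \<open>z \<mapsto> z + c\<close>, the function
  \<open>f(z) = P(exp (\<pi> \<i> z / c))\<close> is a solution.  To obtain \<open>P\<close>, a local parametrization is found by inverting
  an abelian integral, and the duplication formula of the curve extends it from a disc to the
  disc of twice the radius, hence to the plane (\<open>fermat_cubic_meromorphic_parametrization\<close>).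
\<close>

section \<open>Negatively curved metrics on the plane\<close>

text \<open>
  The Laplacian is taken as the sum of the second derivatives along the two axes, because the maximum
  principle needs no more than the one-variable second derivative test on these two lines.
\<close>
definition has_second_deriv_along :: "(complex \<Rightarrow> real) \<Rightarrow> complex \<Rightarrow> complex \<Rightarrow> real \<Rightarrow> bool" where
  "has_second_deriv_along u z e D \<longleftrightarrow>
     (\<exists>u'. (\<forall>\<^sub>F t in nhds 0. ((\<lambda>s. u (z + of_real s * e)) has_real_derivative u' t) (at t)) \<and>
           (u' has_real_derivative D) (at 0))"

definition has_laplacian :: "(complex \<Rightarrow> real) \<Rightarrow> real \<Rightarrow> complex \<Rightarrow> bool" where
  "has_laplacian u L z \<longleftrightarrow>
     (\<exists>D1 D2. has_second_deriv_along u z 1 D1 \<and> has_second_deriv_along u z \<i> D2 \<and> L = D1 + D2)"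

lemma has_second_deriv_along_add:
  assumes "has_second_deriv_along u z e D" "has_second_deriv_along v z e D'"
  shows   "has_second_deriv_along (\<lambda>z. u z + v z) z e (D + D')"
proof -
  from assms obtain u' v'
    where "\<forall>\<^sub>F t in nhds 0. ((\<lambda>s. u (z + of_real s * e)) has_real_derivative u' t) (at t)"
          "(u' has_real_derivative D) (at 0)"
          "\<forall>\<^sub>F t in nhds 0. ((\<lambda>s. v (z + of_real s * e)) has_real_derivative v' t) (at t)"
          "(v' has_real_derivative D') (at 0)"
    unfolding has_second_deriv_along_def by blast
  then show ?thesis
    unfolding has_second_deriv_along_def
    by (intro exI[of _ "\<lambda>t. u' t + v' t"] conjI)
       (auto elim: eventually_elim2 intro: DERIV_add)
qed

lemma has_second_deriv_along_cmult:
  assumes "has_second_deriv_along u z e D"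
  shows   "has_second_deriv_along (\<lambda>z. c * u z) z e (c * D)"
proof -
  from assms obtain u'
    where "\<forall>\<^sub>F t in nhds 0. ((\<lambda>s. u (z + of_real s * e)) has_real_derivative u' t) (at t)"
          "(u' has_real_derivative D) (at 0)"
    unfolding has_second_deriv_along_def by blast
  then show ?thesis
    unfolding has_second_deriv_along_def
    by (intro exI[of _ "\<lambda>t. c * u' t"]) (auto elim!: eventually_mono intro!: DERIV_cmult)
qed

lemma has_laplacian_add:
  assumes "has_laplacian u L z" "has_laplacian v M z"
  shows   "has_laplacian (\<lambda>z. u z + v z) (L + M) z"
proof -
  from assms obtain D1 D2 E1 E2 where
    "has_second_deriv_along u z 1 D1" "has_second_deriv_along u z \<i> D2" "L = D1 + D2"
    "has_second_deriv_along v z 1 E1" "has_second_deriv_along v z \<i> E2" "M = E1 + E2"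
    unfolding has_laplacian_def by blast
  moreover from this have "L + M = (D1 + E1) + (D2 + E2)" by simp
  ultimately show ?thesis
    unfolding has_laplacian_def by (blast intro: has_second_deriv_along_add)
qed

lemma has_laplacian_cmult:
  assumes "has_laplacian u L z"
  shows   "has_laplacian (\<lambda>z. c * u z) (c * L) z"
proof -
  from assms obtain D1 D2 where
    "has_second_deriv_along u z 1 D1" "has_second_deriv_along u z \<i> D2" "L = D1 + D2"
    unfolding has_laplacian_def by blast
  moreover from this have "c * L = c * D1 + c * D2" by (simp add: distrib_left)
  ultimately show ?thesis
    unfolding has_laplacian_def by (blast intro: has_second_deriv_along_cmult)
qed

lemma second_deriv_along_local_max:
  assumes "has_second_deriv_along u z e D" and "\<forall>\<^sub>F w in nhds z. u w \<le> u z"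
  shows   "D \<le> 0"
proof (rule ccontr)
  assume "\<not> D \<le> 0"
  then have D: "D > 0" by simp
  define g where "g = (\<lambda>s::real. u (z + of_real s * e))"
  obtain u' where u': "\<forall>\<^sub>F t in nhds 0. (g has_real_derivative u' t) (at t)"
                      "(u' has_real_derivative D) (at 0)"
    using assms(1) unfolding has_second_deriv_along_def g_def by blast
  have "((\<lambda>s::real. z + of_real s * e) \<longlongrightarrow> z + of_real 0 * e) (nhds 0)"
    by (intro tendsto_intros filterlim_ident)
  then have "filterlim (\<lambda>s::real. z + of_real s * e) (nhds z) (nhds 0)" by simp
  from eventually_compose_filterlim[OF assms(2) this]
  have "\<forall>\<^sub>F s in nhds 0. g s \<le> g 0" by (simp add: g_def)
  with u'(1) have "\<forall>\<^sub>F t in nhds 0. (g has_real_derivative u' t) (at t) \<and> g t \<le> g 0"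
    by eventually_elim auto
  then obtain d where d: "d > 0"
    "\<And>t. \<bar>t\<bar> < d \<Longrightarrow> (g has_real_derivative u' t) (at t)" "\<And>t. \<bar>t\<bar> < d \<Longrightarrow> g t \<le> g 0"
    unfolding eventually_nhds_metric by (auto simp: dist_real_def)
  have "u' 0 = 0"
    by (rule DERIV_local_max[OF d(2)[of 0] d(1)]) (use d in auto)
  moreover obtain d' where d': "d' > 0" "\<And>h. h > 0 \<Longrightarrow> h < d' \<Longrightarrow> u' 0 < u' (0 + h)"
    using DERIV_pos_inc_right[OF u'(2) D] by blast
  ultimately have pos: "u' h > 0" if "h > 0" "h < d'" for h
    using that by auto
  define r where "r = min d d' / 2"
  have r: "r > 0" "r < d" "r < d'" using d(1) d'(1) by (auto simp: r_def)
  have "g 0 < g r"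
  proof (rule DERIV_pos_imp_increasing_open[OF r(1)])
    show "\<exists>y. (g has_real_derivative y) (at x) \<and> 0 < y" if "0 < x" "x < r" for x
      using d(2)[of x] pos[of x] that r by auto
    show "continuous_on {0..r} g"
    proof (rule DERIV_continuous_on)
      show "(g has_real_derivative u' x) (at x within {0..r})" if "x \<in> {0..r}" for x
        using d(2)[of x] that r has_field_derivative_at_within by auto
    qed
  qed
  with d(3)[of r] r show False by auto
qed

lemma laplacian_local_max:
  assumes "has_laplacian u L z" and "\<forall>\<^sub>F w in nhds z. u w \<le> u z"
  shows   "L \<le> 0"
proof -
  from assms(1) obtain D1 D2 where
    "has_second_deriv_along u z 1 D1" "has_second_deriv_along u z \<i> D2" and L: "L = D1 + D2"
    unfolding has_laplacian_def by blast
  from this(1,2)[THEN second_deriv_along_local_max[OF _ assms(2)]] L show ?thesis by simp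
qed

lemma has_second_deriv_along_ln:
  assumes g: "\<And>t. ((\<lambda>s. g (z + of_real s * e)) has_real_derivative g' t) (at t)"
    and g': "(g' has_real_derivative D) (at 0)" and pos: "g z > 0"
  shows "has_second_deriv_along (\<lambda>w. ln (g w)) z e (D / g z - (g' 0 / g z)\<^sup>2)"
proof -
  define p where "p = (\<lambda>s::real. g (z + of_real s * e))"
  have p0: "p 0 = g z" by (simp add: p_def)
  have p: "(p has_real_derivative g' t) (at t)" for t
    using g by (simp add: p_def)
  have "isCont p 0" using p by (rule DERIV_isCont)
  then have "(p \<longlongrightarrow> p 0) (nhds 0)"
    by (simp add: isCont_def tendsto_at_iff_tendsto_nhds)
  then have "\<forall>\<^sub>F t in nhds 0. p t > 0"
    using pos p0 by (intro order_tendstoD(1)[of p "p 0"]) auto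
  then have "\<forall>\<^sub>F t in nhds 0. ((\<lambda>s. ln (p s)) has_real_derivative g' t / p t) (at t)"
    by eventually_elim (auto intro!: derivative_eq_intros p)
  moreover have "((\<lambda>t. g' t / p t) has_real_derivative (D / g z - (g' 0 / g z)\<^sup>2)) (at 0)"
    using pos p0 by (auto intro!: derivative_eq_intros p g' simp: field_simps power2_eq_square)
  ultimately show ?thesis
    unfolding has_second_deriv_along_def p_def by (intro exI conjI)
qed

text \<open>
  The second derivatives of the functions \<open>F i\<close> enter along the axes with the opposite factors
  \<open>1\<close> and \<open>\<i>\<^sup>2 = - 1\<close> and cancel, so only first derivatives survive.  By the Cauchy-Schwarz inequality
  the result is nonnegative; for a single function it is \<open>0\<close>, which says that \<open>ln |F|^2\<close> is harmonic
  off the zeros of \<open>F\<close>.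
\<close>
lemma laplacian_ln_sum_norm_squares:
  fixes F :: "'a \<Rightarrow> complex \<Rightarrow> complex"
  assumes "finite I" and hol: "\<And>i. i \<in> I \<Longrightarrow> F i holomorphic_on UNIV"
    and pos: "(\<Sum>i\<in>I. (cmod (F i z))\<^sup>2) > 0"
  defines "N \<equiv> (\<Sum>i\<in>I. (cmod (F i z))\<^sup>2)"
  shows "has_laplacian (\<lambda>w. ln (\<Sum>i\<in>I. (cmod (F i w))\<^sup>2))
           (4 * (N * (\<Sum>i\<in>I. (cmod (deriv (F i) z))\<^sup>2)
                 - (cmod (\<Sum>i\<in>I. cnj (F i z) * deriv (F i) z))\<^sup>2) / N\<^sup>2) z"
proof -
  define g where "g = (\<lambda>w. \<Sum>i\<in>I. (cmod (F i w))\<^sup>2)"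
  define g1 where "g1 = (\<lambda>e (t::real). \<Sum>i\<in>I. 2 * (F i (z + of_real t * e) \<bullet> (e * deriv (F i) (z + of_real t * e))))"
  define g2 where "g2 = (\<lambda>e. \<Sum>i\<in>I. 2 * (F i z \<bullet> (e * (e * deriv (deriv (F i)) z))
                                 + (e * deriv (F i) z) \<bullet> (e * deriv (F i) z)))"
  have vec: "((\<lambda>s::real. h (z + of_real s * e)) has_vector_derivative e * deriv h (z + of_real t * e)) (at t)"
    if "h holomorphic_on UNIV" for h e and t :: real
  proof -
    have 1: "((\<lambda>s::real. z + of_real s * e) has_vector_derivative e) (at t)"
      by (auto intro!: derivative_eq_intros simp: has_vector_derivative_def scaleR_conv_of_real)
    have 2: "(h has_field_derivative deriv h (z + of_real t * e)) (at (z + of_real t * e))"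
      using that by (intro holomorphic_derivI[of _ UNIV]) auto
    from field_vector_diff_chain_at[OF 1 2] show ?thesis by (simp add: o_def)
  qed
  have ip: "((\<lambda>s. x s \<bullet> y s) has_real_derivative (x t \<bullet> y' + x' \<bullet> y t)) (at t)"
    if "(x has_vector_derivative x') (at t)" "(y has_vector_derivative y') (at t)"
    for x y :: "real \<Rightarrow> complex" and x' y' t
    using that bounded_bilinear.has_vector_derivative[OF bounded_bilinear_inner, of x x' t UNIV y y']
    by (simp add: has_real_derivative_iff_has_vector_derivative)
  have d1: "((\<lambda>s. g (z + of_real s * e)) has_real_derivative g1 e t) (at t)" for e t
  proof -
    have "((\<lambda>s. F i (z + of_real s * e) \<bullet> F i (z + of_real s * e)) has_real_derivative
             2 * (F i (z + of_real t * e) \<bullet> (e * deriv (F i) (z + of_real t * e)))) (at t)" if "i \<in> I" for i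
      using ip[OF vec[OF hol[OF that], of e t] vec[OF hol[OF that], of e t]]
      by (simp add: inner_commute)
    then show ?thesis
      unfolding g_def g1_def power2_norm_eq_inner by (intro DERIV_sum)
  qed
  have d2: "(g1 e has_real_derivative g2 e) (at 0)" for e
  proof -
    have "((\<lambda>t. F i (z + of_real t * e) \<bullet> (e * deriv (F i) (z + of_real t * e))) has_real_derivative
            (F i z \<bullet> (e * (e * deriv (deriv (F i)) z)) + (e * deriv (F i) z) \<bullet> (e * deriv (F i) z))) (at 0)"
      if "i \<in> I" for i
    proof -
      have "((\<lambda>s::real. e * deriv (F i) (z + of_real s * e)) has_vector_derivative
              e * (e * deriv (deriv (F i)) (z + of_real 0 * e))) (at 0)"
        by (intro derivative_intros vec holomorphic_deriv hol that) auto
      from ip[OF vec[OF hol[OF that], of e 0] this] show ?thesis by simp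
    qed
    then show ?thesis
      unfolding g1_def g2_def by (intro DERIV_sum DERIV_cmult)
  qed
  have gz: "g z = N" "N > 0" using pos by (simp_all add: g_def N_def)
  have rotate: "(\<i> * v) \<bullet> (\<i> * v) = (cmod v)\<^sup>2" "v \<bullet> v = (cmod v)\<^sup>2" for v
    by (simp_all add: norm_mult flip: power2_norm_eq_inner)
  have second: "has_second_deriv_along (\<lambda>w. ln (g w)) z e (g2 e / N - (g1 e 0 / N)\<^sup>2)" for e
    using has_second_deriv_along_ln[of g z e "g1 e", OF d1 d2] gz by simp
  have "has_laplacian (\<lambda>w. ln (g w))
          ((g2 1 / N - (g1 1 0 / N)\<^sup>2) + (g2 \<i> / N - (g1 \<i> 0 / N)\<^sup>2)) z"
    using second[of 1] second[of \<i>] unfolding has_laplacian_def by blast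
  moreover have "g2 1 + g2 \<i> = 4 * (\<Sum>i\<in>I. (cmod (deriv (F i) z))\<^sup>2)"
    unfolding g2_def sum.distrib[symmetric] sum_distrib_left
    by (intro sum.cong refl) (simp only: rotate mult_1_left, simp add: inner_complex_def norm_mult)
  moreover have "(g1 1 0)\<^sup>2 + (g1 \<i> 0)\<^sup>2 = 4 * (cmod (\<Sum>i\<in>I. cnj (F i z) * deriv (F i) z))\<^sup>2"
  proof -
    have "g1 1 0 = 2 * Re (\<Sum>i\<in>I. cnj (F i z) * deriv (F i) z)"
      by (simp add: g1_def inner_complex_def sum_distrib_left)
    moreover have "g1 \<i> 0 = - 2 * Im (\<Sum>i\<in>I. cnj (F i z) * deriv (F i) z)"
      by (simp add: g1_def inner_complex_def sum_distrib_left sum_negf[symmetric] algebra_simps)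
    ultimately show ?thesis by (simp add: cmod_power2 power_mult_distrib)
  qed
  moreover have "(g2 1 / N - (g1 1 0 / N)\<^sup>2) + (g2 \<i> / N - (g1 \<i> 0 / N)\<^sup>2) =
                   (N * (g2 1 + g2 \<i>) - ((g1 1 0)\<^sup>2 + (g1 \<i> 0)\<^sup>2)) / N\<^sup>2"
    using gz(2) by (simp add: divide_simps power2_eq_square) (simp add: algebra_simps)
  ultimately show ?thesis
    unfolding g_def by (simp only: mult.left_commute[of N 4] right_diff_distrib)
qed

text \<open>
  Minus twice this function is, up to a constant, the logarithm of the hyperbolic area density of the
  disc of radius \<open>R\<close>.
\<close>
lemma laplacian_ln_disc:
  assumes "cmod (z - a) < R"
  shows "has_laplacian (\<lambda>w. ln (R\<^sup>2 - (cmod (w - a))\<^sup>2)) (- 4 * R\<^sup>2 / (R\<^sup>2 - (cmod (z - a))\<^sup>2)\<^sup>2) z"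
proof -
  define M where "M = R\<^sup>2 - (cmod (z - a))\<^sup>2"
  have M: "M > 0" using assms by (simp add: M_def power_strict_mono)
  define x y where "x = Re (z - a)" and "y = Im (z - a)"
  have eq1: "R\<^sup>2 - (cmod (z + of_real s * 1 - a))\<^sup>2 = R\<^sup>2 - ((x + s)\<^sup>2 + y\<^sup>2)" for s
    by (simp add: x_def y_def cmod_power2 algebra_simps)
  have eq2: "R\<^sup>2 - (cmod (z + of_real s * \<i> - a))\<^sup>2 = R\<^sup>2 - (x\<^sup>2 + (y + s)\<^sup>2)" for s
    by (simp add: x_def y_def cmod_power2 algebra_simps)
  have d1: "((\<lambda>s. R\<^sup>2 - (cmod (z + of_real s * 1 - a))\<^sup>2) has_real_derivative (- 2 * (x + t))) (at t)" for t
    unfolding eq1 by (auto intro!: derivative_eq_intros)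
  have d2: "((\<lambda>s. R\<^sup>2 - (cmod (z + of_real s * \<i> - a))\<^sup>2) has_real_derivative (- 2 * (y + t))) (at t)" for t
    unfolding eq2 by (auto intro!: derivative_eq_intros)
  have dd: "((\<lambda>t. - 2 * (q + t)) has_real_derivative (-2)) (at 0)" for q :: real
    by (auto intro!: derivative_eq_intros)
  have 1: "has_second_deriv_along (\<lambda>w. ln (R\<^sup>2 - (cmod (w - a))\<^sup>2)) z 1
             ((-2) / M - ((-2 * (x + 0)) / M)\<^sup>2)"
    using has_second_deriv_along_ln[where g = "\<lambda>w. R\<^sup>2 - (cmod (w - a))\<^sup>2", OF d1 dd] M
    unfolding M_def by blast
  have 2: "has_second_deriv_along (\<lambda>w. ln (R\<^sup>2 - (cmod (w - a))\<^sup>2)) z \<i>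
             ((-2) / M - ((-2 * (y + 0)) / M)\<^sup>2)"
    using has_second_deriv_along_ln[where g = "\<lambda>w. R\<^sup>2 - (cmod (w - a))\<^sup>2", OF d2 dd] M
    unfolding M_def by blast
  have "- 4 * R\<^sup>2 / M\<^sup>2 = ((-2) / M - ((-2 * (x + 0)) / M)\<^sup>2) + ((-2) / M - ((-2 * (y + 0)) / M)\<^sup>2)"
  proof -
    have "R\<^sup>2 = M + (x\<^sup>2 + y\<^sup>2)" by (simp add: M_def x_def y_def cmod_power2)
    then show ?thesis using M by (simp add: divide_simps power2_eq_square)
  qed
  with 1 2 show ?thesis unfolding has_laplacian_def M_def by metis
qed

text \<open>
  The Ahlfors-Schwarz lemma: compare \<open>\<rho>\<close> with the hyperbolic metric of a disc of radius \<open>R\<close> about \<open>a\<close>.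
  The product \<open>\<rho> * (R^2 - |z - a|^2)^2\<close> vanishes on the boundary circle, so it has an interior maximum,
  where the Laplacian of its logarithm is at most \<open>0\<close>.  This bounds the product by \<open>8 R^2 / \<kappa>\<close>, so that
  \<open>\<rho> a \<le> 8 / (\<kappa> R^2)\<close> for every \<open>R\<close>.  The curvature condition is stated through a local logarithm \<open>u\<close>
  of \<open>\<rho>\<close> since \<open>\<rho>\<close> may have zeros.
\<close>
lemma negatively_curved_metric_vanishes:
  fixes \<rho> :: "complex \<Rightarrow> real"
  assumes cont: "continuous_on UNIV \<rho>" and nonneg: "\<And>z. \<rho> z \<ge> 0" and "\<kappa> > 0"
    and curv: "\<And>z. \<rho> z > 0 \<Longrightarrow> \<exists>u L. (\<forall>\<^sub>F w in nhds z. \<rho> w = exp (u w)) \<and>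
                 has_laplacian u L z \<and> \<kappa> * \<rho> z \<le> L"
  shows "\<rho> a = 0"
proof (rule ccontr)
  assume "\<rho> a \<noteq> 0"
  with nonneg[of a] have \<rho>a: "\<rho> a > 0" by simp
  \<comment> \<open>a radius for which the resulting bound \<open>8 / (\<kappa> R^2)\<close> is below \<open>\<rho> a\<close>\<close>
  define R where "R = sqrt (8 / (\<kappa> * \<rho> a)) + 1"
  have R: "R > 0" "R\<^sup>2 > 8 / (\<kappa> * \<rho> a)"
  proof -
    have "sqrt (8 / (\<kappa> * \<rho> a)) \<ge> 0" using \<rho>a \<open>\<kappa> > 0\<close> by simp
    then show "R > 0" unfolding R_def by linarith
    have "R\<^sup>2 > (sqrt (8 / (\<kappa> * \<rho> a)))\<^sup>2"
      unfolding R_def by (rule power_strict_mono) (use \<rho>a \<open>\<kappa> > 0\<close> in auto)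
    then show "R\<^sup>2 > 8 / (\<kappa> * \<rho> a)" using \<rho>a \<open>\<kappa> > 0\<close> by simp
  qed
  define M where "M = (\<lambda>z. R\<^sup>2 - (cmod (z - a))\<^sup>2)"
  define \<psi> where "\<psi> = (\<lambda>z. \<rho> z * (M z)\<^sup>2)"
  have "continuous_on (cball a R) \<psi>"
    unfolding \<psi>_def M_def by (intro continuous_intros continuous_on_subset[OF cont]) auto
  then obtain z0 where z0: "z0 \<in> cball a R" "\<And>z. z \<in> cball a R \<Longrightarrow> \<psi> z \<le> \<psi> z0"
    using continuous_attains_sup[of "cball a R" \<psi>] R(1) by auto
  have Ma: "M a = R\<^sup>2" by (simp add: M_def)
  have \<psi>a: "\<psi> a = \<rho> a * R\<^sup>2 * R\<^sup>2" by (simp add: \<psi>_def Ma power2_eq_square)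
  then have "\<psi> a > 0" using \<rho>a R(1) by simp
  also have "\<psi> a \<le> \<psi> z0" using R(1) by (intro z0) auto
  finally have "\<psi> z0 > 0" .
  then have \<rho>0: "\<rho> z0 > 0" and "M z0 \<noteq> 0"
    using nonneg[of z0] by (auto simp: \<psi>_def zero_less_mult_iff)
  then have "cmod (z0 - a) \<noteq> R" by (auto simp: M_def)
  with z0(1) have in_ball: "cmod (z0 - a) < R"
    by (simp add: dist_norm norm_minus_commute)
  obtain u L where u: "\<forall>\<^sub>F w in nhds z0. \<rho> w = exp (u w)" "has_laplacian u L z0" "\<kappa> * \<rho> z0 \<le> L"
    using curv[OF \<rho>0] by blast
  have Mpos: "M z > 0" if "z \<in> ball a R" for z
  proof -
    have "cmod (z - a) < R" using that by (simp add: dist_norm norm_minus_commute)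
    then have "(cmod (z - a))\<^sup>2 < R\<^sup>2" by (intro power_strict_mono) auto
    then show ?thesis by (simp add: M_def)
  qed
  have z0b: "z0 \<in> ball a R" using in_ball by (simp add: dist_norm norm_minus_commute)
  define v where "v = (\<lambda>z. u z + 2 * ln (M z))"
  have "\<forall>\<^sub>F w in nhds z0. w \<in> ball a R"
    using z0b by (intro eventually_nhds_in_open) auto
  with u(1) have "\<forall>\<^sub>F w in nhds z0. v w \<le> v z0"
  proof eventually_elim
    case (elim w)
    have expv: "exp (v z) = \<psi> z" if "\<rho> z = exp (u z)" "z \<in> ball a R" for z
      using that Mpos[OF that(2)] exp_of_nat_mult[of 2 "ln (M z)"]
      by (simp add: v_def \<psi>_def exp_add)
    have "\<rho> z0 = exp (u z0)" using u(1) by (rule eventually_nhds_x_imp_x)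
    with expv[of z0] expv[OF elim] z0(2)[of w] z0b elim(2) have "exp (v w) \<le> exp (v z0)"
      by auto
    then show ?case by simp
  qed
  moreover have "has_laplacian v (L + 2 * (- 4 * R\<^sup>2 / (M z0)\<^sup>2)) z0"
    unfolding v_def M_def using in_ball
    by (intro has_laplacian_add has_laplacian_cmult u laplacian_ln_disc)
  ultimately have "L + 2 * (- 4 * R\<^sup>2 / (M z0)\<^sup>2) \<le> 0"
    by (rule laplacian_local_max[rotated])
  with u(3) have "\<kappa> * \<rho> z0 \<le> 8 * R\<^sup>2 / (M z0)\<^sup>2" by simp
  with \<open>M z0 \<noteq> 0\<close> have "\<kappa> * \<psi> z0 \<le> 8 * R\<^sup>2"
    by (simp add: \<psi>_def field_simps)
  moreover have "\<kappa> * \<psi> a \<le> \<kappa> * \<psi> z0" using \<open>\<psi> a \<le> \<psi> z0\<close> \<open>\<kappa> > 0\<close> by simp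
  ultimately have "(\<kappa> * \<rho> a * R\<^sup>2) * R\<^sup>2 \<le> 8 * R\<^sup>2" unfolding \<psi>a by (simp add: mult.assoc)
  then have "\<kappa> * \<rho> a * R\<^sup>2 \<le> 8" using R(1) by (simp add: mult_le_cancel_right)
  with R(2) \<rho>a \<open>\<kappa> > 0\<close> show False by (simp add: field_simps)
qed

section \<open>Entire curves in Fermat curves of degree at least four\<close>

lemma open_nonzero_set:
  fixes k :: "complex \<Rightarrow> complex"
  assumes "k holomorphic_on UNIV"
  shows "open {z. k z \<noteq> 0}"
  using holomorphic_on_imp_continuous_on[OF assms] by (intro open_Collect_neq continuous_intros) auto

text \<open>
  Lagrange's identity for the Hermitian cross product.
\<close>
lemma norm_cross_squares:
  fixes x1 x2 x3 y1 y2 y3 :: complex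
  shows "((cmod x1)\<^sup>2 + (cmod x2)\<^sup>2 + (cmod x3)\<^sup>2) * ((cmod y1)\<^sup>2 + (cmod y2)\<^sup>2 + (cmod y3)\<^sup>2)
           - (cmod (cnj x1 * y1 + cnj x2 * y2 + cnj x3 * y3))\<^sup>2
         = (cmod (x1 * y2 - x2 * y1))\<^sup>2 + (cmod (x1 * y3 - x3 * y1))\<^sup>2 + (cmod (x2 * y3 - x3 * y2))\<^sup>2"
  unfolding cmod_power2 by (simp add: power2_eq_square algebra_simps)

text \<open>
  A crude power-mean inequality: the sum is at most three times its largest term.
\<close>
lemma power_sum3_le:
  fixes a b c :: real
  assumes "a \<ge> 0" "b \<ge> 0" "c \<ge> 0"
  shows "(a + b + c) ^ j \<le> 3 ^ j * (a ^ j + b ^ j + c ^ j)"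
proof -
  define m where "m = max a (max b c)"
  have "(a + b + c) ^ j \<le> (3 * m) ^ j"
    using assms by (intro power_mono) (auto simp: m_def)
  moreover have "m ^ j \<le> a ^ j + b ^ j + c ^ j"
  proof -
    have "m = a \<or> m = b \<or> m = c" by (auto simp: m_def max_def)
    moreover have "a ^ j \<ge> 0" "b ^ j \<ge> 0" "c ^ j \<ge> 0" using assms by auto
    ultimately show ?thesis by auto
  qed
  ultimately show ?thesis
    by (simp add: power_mult_distrib) (meson dual_order.trans mult_left_mono zero_le_numeral zero_le_power)
qed

text \<open>
  Both \<open>(X, Y, Z)\<close> and its derivative are orthogonal to \<open>(X^(n-1), Y^(n-1), - Z^(n-1))\<close>, so their cross
  product \<open>(A, B, C)\<close> is a multiple \<open>w\<close> of that vector.  With \<open>N = |X|^2 + |Y|^2 + |Z|^2\<close>, Lagrange's identity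
  gives \<open>\<Delta> ln N = 4 |w|^2 (|X|^(2(n-1)) + |Y|^(2(n-1)) + |Z|^(2(n-1))) / N^2\<close>, which is at least a constant
  times \<open>|w|^2 N^(n-3)\<close>.  As \<open>ln |w|^2\<close> is harmonic, \<open>|w|^2 N^(n-3)\<close> is a metric to which the
  Ahlfors-Schwarz lemma applies; the exponent \<open>n - 3\<close> has to be positive, which is where \<open>n \<ge> 4\<close> enters.
\<close>
lemma entire_fermat_curve_trivial:
  fixes X Y Z :: "complex \<Rightarrow> complex"
  assumes hol: "X holomorphic_on UNIV" "Y holomorphic_on UNIV" "Z holomorphic_on UNIV"
    and n: "n \<ge> 4"
    and eq: "\<And>z. X z ^ n + Y z ^ n = Z z ^ n"
    and nz: "\<And>z. X z \<noteq> 0 \<or> Y z \<noteq> 0 \<or> Z z \<noteq> 0"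
  shows "deriv X z * Z z = X z * deriv Z z"
proof -
  obtain k where k: "n = k + 3" "k \<ge> 1" using n that[of "n - 3"] by auto
  define A where "A = (\<lambda>z. deriv X z * Z z - X z * deriv Z z)"
  define B where "B = (\<lambda>z. deriv X z * Y z - X z * deriv Y z)"
  define C where "C = (\<lambda>z. deriv Y z * Z z - Y z * deriv Z z)"
  define p q r where "p = (\<lambda>z. X z ^ (k + 2))" and "q = (\<lambda>z. Y z ^ (k + 2))" and "r = (\<lambda>z. Z z ^ (k + 2))"
  \<comment> \<open>the two quotients agree where both make sense, and \<open>Y\<close> and \<open>Z\<close> have no common zero\<close>
  define w where "w = (\<lambda>z. if Y z \<noteq> 0 then A z / q z else B z / r z)"
  have tangent: "p z * deriv X z + q z * deriv Y z = r z * deriv Z z" for z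
  proof -
    have d: "((\<lambda>z. h z ^ n) has_field_derivative of_nat n * (h z ^ (k + 2) * deriv h z)) (at z)"
      if "h holomorphic_on UNIV" for h
    proof -
      have "(h has_field_derivative deriv h z) (at z)"
        using that by (intro holomorphic_derivI[of _ UNIV]) auto
      from DERIV_power[OF this, of n] show ?thesis
        by (simp add: k(1) mult_ac)
    qed
    have "((\<lambda>z. X z ^ n + Y z ^ n) has_field_derivative
             of_nat n * (p z * deriv X z) + of_nat n * (q z * deriv Y z)) (at z)"
      unfolding p_def q_def by (intro DERIV_add d hol)
    moreover have "((\<lambda>z. X z ^ n + Y z ^ n) has_field_derivative of_nat n * (r z * deriv Z z)) (at z)"
      unfolding r_def eq by (intro d hol)
    ultimately have "of_nat n * (p z * deriv X z) + of_nat n * (q z * deriv Y z) = of_nat n * (r z * deriv Z z)"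
      by (rule DERIV_unique)
    then have "of_nat n * (p z * deriv X z + q z * deriv Y z - r z * deriv Z z) = 0"
      by (simp add: algebra_simps)
    then show ?thesis using n by simp
  qed
  have point: "p z * X z + q z * Y z = r z * Z z" for z
    using eq[of z] by (simp add: p_def q_def r_def k(1) eval_nat_numeral mult_ac)
  have rel: "r z * A z = q z * B z" "p z * B z = - (r z * C z)" "p z * A z = - (q z * C z)" for z
    using tangent[of z] point[of z] unfolding A_def B_def C_def by algebra+
  have zero: "X z = 0" if "Y z = 0" "Z z = 0" for z
    using eq[of z] that n by (auto simp: power_0_left)
  have w: "A z = w z * q z" "B z = w z * r z" "C z = - (w z * p z)" for z
  proof -
    have "A z = w z * q z \<and> B z = w z * r z \<and> C z = - (w z * p z)"
    proof (cases "Y z = 0")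
      case False
      then have q: "q z \<noteq> 0" and A: "A z = w z * q z" by (auto simp: q_def w_def)
      have "q z * (B z - w z * r z) = 0" "q z * (C z + w z * p z) = 0"
        using rel[of z] A by algebra+
      with q A show ?thesis by (simp add: eq_neg_iff_add_eq_0)
    next
      case True
      then have r: "r z \<noteq> 0" and q: "q z = 0" using zero[of z] nz[of z] by (auto simp: r_def q_def)
      then have B: "B z = w z * r z" using True by (simp add: w_def)
      have "r z * A z = 0" "r z * (C z + w z * p z) = 0"
        using rel[of z] B q by algebra+
      with r B q show ?thesis by (simp add: eq_neg_iff_add_eq_0)
    qed
    then show "A z = w z * q z" "B z = w z * r z" "C z = - (w z * p z)" by auto
  qed
  have holABqr: "A holomorphic_on UNIV" "B holomorphic_on UNIV" "q holomorphic_on UNIV" "r holomorphic_on UNIV"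
    unfolding A_def B_def q_def r_def by (intro holomorphic_intros hol holomorphic_deriv open_UNIV)+
  have "w holomorphic_on {z. Y z \<noteq> 0} \<union> {z. Z z \<noteq> 0}"
  proof (intro holomorphic_on_Un open_nonzero_set hol)
    have "(\<lambda>z. A z / q z) holomorphic_on {z. Y z \<noteq> 0}"
      by (intro holomorphic_intros holomorphic_on_subset[OF holABqr(1)] holomorphic_on_subset[OF holABqr(3)])
         (auto simp: q_def)
    then show "w holomorphic_on {z. Y z \<noteq> 0}"
      by (rule holomorphic_transform) (auto simp: w_def)
    have "(\<lambda>z. B z / r z) holomorphic_on {z. Z z \<noteq> 0}"
      by (intro holomorphic_intros holomorphic_on_subset[OF holABqr(2)] holomorphic_on_subset[OF holABqr(4)])
         (auto simp: r_def)
    then show "w holomorphic_on {z. Z z \<noteq> 0}"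
      by (rule holomorphic_transform) (simp add: w r_def)
  qed
  moreover have "{z. Y z \<noteq> 0} \<union> {z. Z z \<noteq> 0} = UNIV" using zero nz by blast
  ultimately have holw: "w holomorphic_on UNIV" by simp

  define N where "N = (\<lambda>z. (cmod (X z))\<^sup>2 + (cmod (Y z))\<^sup>2 + (cmod (Z z))\<^sup>2)"
  have Npos: "N z > 0" for z
    using nz[of z] unfolding N_def by (metis add_nonneg_pos add_pos_nonneg zero_le_power2 zero_less_norm_iff zero_less_power add_nonneg_nonneg)
  define \<rho> where "\<rho> = (\<lambda>z. (cmod (w z))\<^sup>2 * N z ^ k)"
  define \<kappa> :: real where "\<kappa> = 4 * k / 3 ^ (k + 2)"
  have "\<rho> z = 0" for z
  proof (rule negatively_curved_metric_vanishes)
    show "continuous_on UNIV \<rho>"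
      unfolding \<rho>_def N_def by (intro continuous_intros holomorphic_on_imp_continuous_on holw hol)
    show "\<rho> z \<ge> 0" for z using Npos[of z] by (simp add: \<rho>_def)
    show "\<kappa> > 0" using k(2) by (simp add: \<kappa>_def)
  next
    fix z assume "\<rho> z > 0"
    then have wz: "w z \<noteq> 0" by (auto simp: \<rho>_def)
    define u where "u = (\<lambda>z. ln ((cmod (w z))\<^sup>2) + k * ln (N z))"
    have "isCont w z" using holw holomorphic_on_imp_continuous_on continuous_on_eq_continuous_at by blast
    with wz have "\<forall>\<^sub>F v in nhds z. w v \<noteq> 0"
      using continuous_at_avoid[of z w 0] by (auto simp: eventually_nhds_metric dist_commute)
    then have "\<forall>\<^sub>F v in nhds z. \<rho> v = exp (u v)"
    proof eventually_elim
      case (elim v)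
      then show ?case using Npos[of v] exp_of_nat_mult[of k "ln (N v)"]
        by (simp add: \<rho>_def u_def exp_add)
    qed
    moreover define L where "L = k * (4 * ((cmod (A z))\<^sup>2 + (cmod (B z))\<^sup>2 + (cmod (C z))\<^sup>2) / (N z)\<^sup>2)"
    have "has_laplacian u (0 + L) z"
      unfolding u_def L_def
    proof (intro has_laplacian_add has_laplacian_cmult)
      show "has_laplacian (\<lambda>z. ln ((cmod (w z))\<^sup>2)) 0 z"
        using laplacian_ln_sum_norm_squares[of "{()}" "\<lambda>_. w" z] wz holw
        by (simp add: norm_mult power_mult_distrib)
      define F where "F = (\<lambda>i::nat. if i = 0 then X else if i = 1 then Y else Z)"
      have I: "{0,1,2::nat} = insert 0 (insert 1 {2})" by auto
      have "has_laplacian (\<lambda>w. ln (\<Sum>i\<in>{0,1,2}. (cmod (F i w))\<^sup>2))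
           (4 * ((\<Sum>i\<in>{0,1,2}. (cmod (F i z))\<^sup>2) * (\<Sum>i\<in>{0,1,2}. (cmod (deriv (F i) z))\<^sup>2)
                 - (cmod (\<Sum>i\<in>{0,1,2}. cnj (F i z) * deriv (F i) z))\<^sup>2) / (\<Sum>i\<in>{0,1,2}. (cmod (F i z))\<^sup>2)\<^sup>2) z"
        using Npos[of z] hol by (intro laplacian_ln_sum_norm_squares) (auto simp: F_def N_def add.assoc)
      then have "has_laplacian (\<lambda>z. ln (N z))
          (4 * (N z * ((cmod (deriv X z))\<^sup>2 + (cmod (deriv Y z))\<^sup>2 + (cmod (deriv Z z))\<^sup>2)
                 - (cmod (cnj (X z) * deriv X z + cnj (Y z) * deriv Y z + cnj (Z z) * deriv Z z))\<^sup>2) / (N z)\<^sup>2) z"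
        by (simp add: F_def N_def add.assoc)
      moreover have "N z * ((cmod (deriv X z))\<^sup>2 + (cmod (deriv Y z))\<^sup>2 + (cmod (deriv Z z))\<^sup>2)
                 - (cmod (cnj (X z) * deriv X z + cnj (Y z) * deriv Y z + cnj (Z z) * deriv Z z))\<^sup>2
               = (cmod (A z))\<^sup>2 + (cmod (B z))\<^sup>2 + (cmod (C z))\<^sup>2"
        unfolding N_def norm_cross_squares A_def B_def C_def
        by (simp add: norm_minus_commute mult.commute)
      ultimately show "has_laplacian (\<lambda>z. ln (N z))
          (4 * ((cmod (A z))\<^sup>2 + (cmod (B z))\<^sup>2 + (cmod (C z))\<^sup>2) / (N z)\<^sup>2) z"
        by simp
    qed
    moreover have "\<kappa> * \<rho> z \<le> 0 + L"
    proof -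
      have square_power: "((cmod a)\<^sup>2) ^ j = (cmod (a ^ j))\<^sup>2" for a :: complex and j
        by (metis norm_power power_mult mult.commute)
      have "N z ^ (k + 2) \<le> 3 ^ (k + 2) * (((cmod (X z))\<^sup>2) ^ (k + 2) + ((cmod (Y z))\<^sup>2) ^ (k + 2) + ((cmod (Z z))\<^sup>2) ^ (k + 2))"
        unfolding N_def by (rule power_sum3_le) auto
      also have "\<dots> = 3 ^ (k + 2) * ((cmod (p z))\<^sup>2 + (cmod (q z))\<^sup>2 + (cmod (r z))\<^sup>2)"
        unfolding p_def q_def r_def by (simp only: square_power)
      finally have "(cmod (w z))\<^sup>2 * N z ^ (k + 2) \<le> (cmod (w z))\<^sup>2 * (3 ^ (k + 2) * ((cmod (p z))\<^sup>2 + (cmod (q z))\<^sup>2 + (cmod (r z))\<^sup>2))"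
        by (intro mult_left_mono) auto
      also have "\<dots> = 3 ^ (k + 2) * ((cmod (A z))\<^sup>2 + (cmod (B z))\<^sup>2 + (cmod (C z))\<^sup>2)"
        unfolding w by (simp add: norm_mult power_mult_distrib algebra_simps)
      finally have "\<rho> z * (N z)\<^sup>2 \<le> 3 ^ (k + 2) * ((cmod (A z))\<^sup>2 + (cmod (B z))\<^sup>2 + (cmod (C z))\<^sup>2)"
        by (simp add: \<rho>_def power_add power2_eq_square mult_ac)
      then have "\<rho> z / 3 ^ (k + 2) \<le> ((cmod (A z))\<^sup>2 + (cmod (B z))\<^sup>2 + (cmod (C z))\<^sup>2) / (N z)\<^sup>2"
        using Npos[of z] by (simp add: field_simps)
      then have "4 * k * (\<rho> z / 3 ^ (k + 2)) \<le> 4 * k * (((cmod (A z))\<^sup>2 + (cmod (B z))\<^sup>2 + (cmod (C z))\<^sup>2) / (N z)\<^sup>2)"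
        by (intro mult_left_mono) auto
      then show ?thesis by (simp add: \<kappa>_def L_def algebra_simps)
    qed
    ultimately show "\<exists>u L. (\<forall>\<^sub>F w in nhds z. \<rho> w = exp (u w)) \<and> has_laplacian u L z \<and> \<kappa> * \<rho> z \<le> L"
      by blast
  qed
  from this[of z] have "w z = 0" using less_imp_neq[OF Npos[of z]] by (simp add: \<rho>_def)
  then have "A z = 0" using w(1)[of z] by simp
  then show ?thesis by (simp add: A_def)
qed

section \<open>Entire solutions of the Fermat equation\<close>

text \<open>
  Every zero of \<open>F\<close> is a zero of \<open>f\<close> and has \<open>n\<close> times its order.  Weierstrass' theorem provides an entire \<open>g\<close>
  with exactly those zeros of \<open>f\<close>, with their orders, at which \<open>F\<close> vanishes; then \<open>F / g^n\<close> is entire without zeros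
  and has an \<open>n\<close>-th root.
\<close>
lemma entire_coprime_factor_is_power:
  fixes f F G :: "complex \<Rightarrow> complex"
  assumes hol: "f holomorphic_on UNIV" "F holomorphic_on UNIV" "G holomorphic_on UNIV"
    and n: "n > 0" and eq: "\<And>z. f z ^ n = F z * G z"
    and coprime: "\<And>z. F z \<noteq> 0 \<or> G z \<noteq> 0" and nz: "f z0 \<noteq> 0"
  obtains g where "g holomorphic_on UNIV" "\<And>z. F z = g z ^ n"
proof -
  have no_limpt: "\<not> z islimpt {w. f w = 0}" for z
  proof
    assume "z islimpt {w. f w = 0}"
    then have "f z0 = 0"
      by (rule analytic_continuation[OF hol(1) open_UNIV connected_UNIV subset_UNIV UNIV_I]) auto
    with nz show False by contradiction
  qed
  define T where "T = {z. f z = 0 \<and> F z \<noteq> 0}"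
  \<comment> \<open>Weierstrass factorization on \<open>A\<close> ignores the zeros of \<open>f\<close> in \<open>T\<close>, which belong to \<open>G\<close>\<close>
  define A where "A = UNIV - T"
  have "T sparse_in UNIV"
    unfolding sparse_in_open[OF open_UNIV] T_def
    using no_limpt islimpt_subset[of _ "{z. f z = 0 \<and> F z \<noteq> 0}" "{w. f w = 0}"] by blast
  then have A: "open A" "connected A"
    unfolding A_def by (auto intro: open_diff_sparse_pts sparse_imp_connected)
  have hA: "f holomorphic_on A" using hol(1) by (rule holomorphic_on_subset) auto
  obtain h g where hg: "h holomorphic_on A" "g holomorphic_on UNIV"
    "\<forall>z. g z = 0 \<longleftrightarrow> (\<forall>z\<in>A. f z = 0) \<or> (z \<in> A \<and> f z = 0)"
    "\<forall>z\<in>A. h z \<noteq> 0" "\<forall>z\<in>A. f z = h z * g z"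
  proof (rule weierstrass_factorization[OF hA A])
    show "\<not> z islimpt {w \<in> A. f w = 0}" for z
      using no_limpt islimpt_subset[of z "{w \<in> A. f w = 0}" "{w. f w = 0}"] by blast
  qed blast
  have "z0 \<in> A" using nz by (auto simp: A_def T_def)
  have Ff: "f z = 0" if "F z = 0" for z using eq[of z] n that by auto
  have g0: "g z = 0 \<longleftrightarrow> F z = 0" for z
    using hg(3) \<open>z0 \<in> A\<close> nz Ff by (auto simp: A_def T_def)
  \<comment> \<open>\<open>F / g^n\<close> with its removable singularities filled in by means of \<open>f = h g\<close>\<close>
  define H where "H = (\<lambda>z. if F z \<noteq> 0 then F z / g z ^ n else h z ^ n / G z)"
  have H2: "H z = h z ^ n / G z" if "z \<in> A" "G z \<noteq> 0" for z
    using that eq[of z] hg(4,5) g0[of z] n by (auto simp: H_def field_simps power_mult_distrib)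
  have "H holomorphic_on {z. F z \<noteq> 0} \<union> (A \<inter> {z. G z \<noteq> 0})"
  proof (intro holomorphic_on_Un open_Int open_nonzero_set hol A)
    have "(\<lambda>z. F z / g z ^ n) holomorphic_on {z. F z \<noteq> 0}"
      by (intro holomorphic_intros holomorphic_on_subset[OF hol(2)] holomorphic_on_subset[OF hg(2)]) (auto simp: g0)
    then show "H holomorphic_on {z. F z \<noteq> 0}"
      by (rule holomorphic_transform) (auto simp: H_def)
    have "(\<lambda>z. h z ^ n / G z) holomorphic_on (A \<inter> {z. G z \<noteq> 0})"
      by (intro holomorphic_intros holomorphic_on_subset[OF hol(3)] holomorphic_on_subset[OF hg(1)]) auto
    then show "H holomorphic_on (A \<inter> {z. G z \<noteq> 0})"
      by (rule holomorphic_transform) (auto simp: H2)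
  qed
  moreover have "{z. F z \<noteq> 0} \<union> (A \<inter> {z. G z \<noteq> 0}) = UNIV"
    using coprime by (auto simp: A_def T_def)
  ultimately have "H holomorphic_on UNIV" by simp
  moreover have "H z \<noteq> 0" for z
  proof (cases "F z = 0")
    case True
    then have "z \<in> A" "G z \<noteq> 0" using coprime[of z] by (auto simp: A_def T_def)
    with hg(4) H2 show ?thesis by auto
  next
    case False
    then show ?thesis using g0[of z] by (simp add: H_def)
  qed
  ultimately obtain l where l: "l holomorphic_on UNIV" "\<And>z. exp (l z) = H z"
    using holomorphic_logarithm_exists[of UNIV H 0] by auto
  show ?thesis
  proof (rule that[of "\<lambda>z. exp (l z / of_nat n) * g z"])
    show "(\<lambda>z. exp (l z / of_nat n) * g z) holomorphic_on UNIV"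
      by (intro holomorphic_intros l hg) (use n in auto)
    show "F z = (exp (l z / of_nat n) * g z) ^ n" for z
    proof -
      have "exp (l z / of_nat n) ^ n = H z"
        using n by (simp add: l(2) flip: exp_of_nat_mult)
      then show ?thesis using g0[of z] n by (auto simp: H_def power_mult_distrib)
    qed
  qed
qed

lemma primitive_root_of_unity:
  assumes "n \<ge> (3::nat)"
  obtains \<eta> :: complex where "\<eta> ^ n = 1" "\<eta> \<noteq> 0" "\<eta> \<noteq> 1" "\<eta>\<^sup>2 \<noteq> 1"
proof
  define e where "e = (\<lambda>j::nat. exp (2 * of_real pi * \<i> * of_nat j / of_nat n :: complex))"
  have 1: "e j = 1 \<longleftrightarrow> n dvd j" for j
    using complex_root_unity_eq_1[of n j] assms by (simp add: e_def)
  have pow: "e 1 ^ j = e j" for j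
    unfolding e_def exp_of_nat_mult[symmetric] by (simp add: mult_ac)
  show "e 1 ^ n = 1" unfolding pow 1 by simp
  show "e 1 \<noteq> 1" unfolding 1 using assms by auto
  show "(e 1)\<^sup>2 \<noteq> 1" unfolding pow 1 using assms by (auto dest: dvd_imp_le)
  show "e 1 \<noteq> 0" by (simp add: e_def)
qed

text \<open>
  After scaling \<open>v\<close> to \<open>y\<close>, the linear factors \<open>u - \<eta>^j y\<close> of \<open>u^n - y^n = b\<close> have no zeros.  Of three such
  factors each is a linear combination of the other two, so the quotient of two of them omits
  both \<open>0\<close> and the value at which the third would vanish.
\<close>
lemma entire_power_plus_power_const:
  fixes u v :: "complex \<Rightarrow> complex"
  assumes hol: "u holomorphic_on UNIV" "v holomorphic_on UNIV"
    and n: "n \<ge> 3" and "a \<noteq> 0" "b \<noteq> 0"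
    and eq: "\<And>z. u z ^ n = a * v z ^ n + b"
  shows "\<exists>C. \<forall>z. v z ^ n = C"
proof -
  obtain \<alpha> where \<alpha>: "\<alpha> ^ n = a"
  proof
    show "exp (Ln a / of_nat n) ^ n = a"
      using n \<open>a \<noteq> 0\<close> by (simp flip: exp_of_nat_mult)
  qed
  then have "\<alpha> \<noteq> 0" using \<open>a \<noteq> 0\<close> n by (auto simp: power_0_left)
  define y where "y = (\<lambda>z. \<alpha> * v z)"
  have eqy: "u z ^ n - y z ^ n = b" for z using eq[of z] by (simp add: y_def power_mult_distrib \<alpha>)
  obtain \<eta> :: complex where \<eta>n: "\<eta> ^ n = 1" and \<eta>0: "\<eta> \<noteq> 0" and \<eta>1: "\<eta> \<noteq> 1" "\<eta>\<^sup>2 \<noteq> 1"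
    by (rule primitive_root_of_unity[OF n])
  have fact_nz: "u z \<noteq> \<eta> ^ j * y z" for z j
  proof
    assume "u z = \<eta> ^ j * y z"
    then have "u z ^ n = (\<eta> ^ n) ^ j * y z ^ n"
      by (simp add: power_mult_distrib mult.commute flip: power_mult)
    with eqy[of z] \<eta>n \<open>b \<noteq> 0\<close> show False by simp
  qed
  define q where "q = (\<lambda>z. (u z - y z) / (u z - \<eta> * y z))"
  have den: "u z - \<eta> * y z \<noteq> 0" and num: "u z - y z \<noteq> 0" and third: "u z - \<eta>\<^sup>2 * y z \<noteq> 0" for z
    using fact_nz[of z 0] fact_nz[of z 1] fact_nz[of z 2] by auto
  have "q holomorphic_on UNIV"
    unfolding q_def y_def by (intro holomorphic_intros hol) (use den in \<open>auto simp: y_def\<close>)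
  moreover have q0: "q z \<noteq> 0" for z using num den by (simp add: q_def)
  moreover have "q z * \<eta> \<noteq> 1 + \<eta>" for z
  proof
    assume "q z * \<eta> = 1 + \<eta>"
    then have "(u z - y z) * \<eta> = (1 + \<eta>) * (u z - \<eta> * y z)"
      using den[of z] by (simp add: q_def field_simps)
    then have "u z - \<eta>\<^sup>2 * y z = 0" by algebra
    with third show False by blast
  qed
  then have "q z \<noteq> (1 + \<eta>) / \<eta>" for z using \<eta>0 by (auto simp: field_simps)
  moreover have "0 \<noteq> (1 + \<eta>) / \<eta>"
  proof
    assume "0 = (1 + \<eta>) / \<eta>"
    then have "\<eta> = -1" using \<eta>0 by (simp add: add_eq_0_iff)
    with \<eta>1 show False by simp
  qed
  ultimately obtain c where c: "q = (\<lambda>_. c)"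
    by (auto intro: little_Picard[of q 0 "(1 + \<eta>) / \<eta>"])
  have lin: "(1 - c) * u z = (1 - c * \<eta>) * y z" for z
  proof -
    have "u z - y z = c * (u z - \<eta> * y z)"
      using den[of z] fun_cong[OF c, of z] by (simp add: q_def field_simps)
    then show ?thesis by algebra
  qed
  have "\<exists>C. \<forall>z. y z ^ n = C"
  proof (cases "c = 1")
    case True
    then have "y z = 0" for z using lin[of z] \<eta>1 by simp
    then show ?thesis by auto
  next
    case False
    define l where "l = (1 - c * \<eta>) / (1 - c)"
    have "u z = l * y z" for z using lin[of z] False by (simp add: l_def field_simps)
    then have "(l ^ n - 1) * y z ^ n = b" for z
      using eqy[of z] by (simp add: power_mult_distrib algebra_simps)
    moreover from this[of 0] have "l ^ n \<noteq> 1" using \<open>b \<noteq> 0\<close> by auto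
    ultimately have "y z ^ n = b / (l ^ n - 1)" for z by (simp add: field_simps)
    then show ?thesis by blast
  qed
  then obtain C where "\<And>z. \<alpha> ^ n * v z ^ n = C" by (auto simp: y_def power_mult_distrib)
  then have "v z ^ n = C / \<alpha> ^ n" for z using \<open>\<alpha> \<noteq> 0\<close> by (simp add: field_simps)
  then show ?thesis by blast
qed

text \<open>
  The first conic is parametrized by \<open>E = y1 + sqrt a * x\<close>, which has no zeros since
  \<open>(y1 + sqrt a * x) (y1 - sqrt a * x) = b\<close>.  Substituting into the second conic makes a quadratic polynomial in
  \<open>E^2\<close> a square; its roots \<open>\<tau>1, \<tau>2\<close> are distinct and nonzero by the conditions on the coefficients, so
  \<open>E^2 - \<tau>1\<close> is itself a square \<open>k^2\<close>.  As \<open>E\<close> has no zeros, \<open>k\<close> omits both square roots of \<open>- \<tau>1\<close>.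
\<close>
lemma entire_intersecting_conics_const:
  fixes x y1 y2 :: "complex \<Rightarrow> complex"
  assumes hol: "x holomorphic_on UNIV" "y1 holomorphic_on UNIV" "y2 holomorphic_on UNIV"
    and nz: "a \<noteq> 0" "b \<noteq> 0" "c \<noteq> 0" "d \<noteq> 0" "a * d \<noteq> b * c"
    and eq1: "\<And>z. (y1 z)\<^sup>2 = a * (x z)\<^sup>2 + b" and eq2: "\<And>z. (y2 z)\<^sup>2 = c * (x z)\<^sup>2 + d"
  shows "\<exists>C. \<forall>z. (x z)\<^sup>2 = C"
proof (cases "\<forall>z. y2 z = 0")
  case True
  have "(x z)\<^sup>2 = - d / c" for z
    using eq2[of z] True \<open>c \<noteq> 0\<close> by (simp add: field_simps eq_neg_iff_add_eq_0)
  then show ?thesis by blast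
next
  case False
  then obtain z0 where z0: "y2 z0 \<noteq> 0" by blast
  define \<alpha> where "\<alpha> = csqrt a"
  have \<alpha>: "\<alpha>\<^sup>2 = a" "\<alpha> \<noteq> 0" using nz by (auto simp: \<alpha>_def)
  define E where "E = (\<lambda>z. y1 z + \<alpha> * x z)"
  have "E z * (y1 z - \<alpha> * x z) = b" for z
    using eq1[of z] \<alpha>(1) unfolding E_def by algebra
  then have E0: "E z \<noteq> 0" for z using \<open>b \<noteq> 0\<close> by (metis mult_zero_left)
  have xE: "2 * (\<alpha> * x z) * E z = (E z)\<^sup>2 - b" for z
    using eq1[of z] \<alpha>(1) unfolding E_def by algebra
  have xE2: "4 * a * (x z)\<^sup>2 * (E z)\<^sup>2 = ((E z)\<^sup>2 - b)\<^sup>2" for z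
    using xE[of z] \<alpha>(1) by algebra
  \<comment> \<open>\<open>\<delta>^2\<close> is a quarter of the discriminant of \<open>c T^2 + (4 a d - 2 b c) T + c b^2\<close>, whose roots are \<open>\<tau>1, \<tau>2\<close>\<close>
  define \<delta> where "\<delta> = csqrt (4 * a * d * (a * d - b * c))"
  have \<delta>: "\<delta>\<^sup>2 = 4 * a * d * (a * d - b * c)" by (simp add: \<delta>_def)
  then have \<delta>0: "\<delta> \<noteq> 0" using nz by auto
  define \<tau>1 \<tau>2 where "\<tau>1 = (b * c - 2 * a * d + \<delta>) / c" and "\<tau>2 = (b * c - 2 * a * d - \<delta>) / c"
  have sum: "c * (\<tau>1 + \<tau>2) = 2 * b * c - 4 * a * d"
    using \<open>c \<noteq> 0\<close> by (simp add: \<tau>1_def \<tau>2_def field_simps)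
  have prod: "\<tau>1 * \<tau>2 = b\<^sup>2"
  proof -
    have "(c * \<tau>1) * (c * \<tau>2) = (b * c - 2 * a * d + \<delta>) * (b * c - 2 * a * d - \<delta>)"
      using \<open>c \<noteq> 0\<close> by (simp add: \<tau>1_def \<tau>2_def)
    also have "\<dots> = c * c * b\<^sup>2" using \<delta> by algebra
    finally show ?thesis using \<open>c \<noteq> 0\<close> by simp
  qed
  have "c * (\<tau>1 - \<tau>2) = 2 * \<delta>" using \<open>c \<noteq> 0\<close> by (simp add: \<tau>1_def \<tau>2_def field_simps)
  then have ne: "\<tau>1 \<noteq> \<tau>2" using \<delta>0 by auto
  have "\<tau>1 \<noteq> 0" using prod \<open>b \<noteq> 0\<close> by auto
  have "(2 * \<alpha> * E z * y2 z)\<^sup>2 = ((E z)\<^sup>2 - \<tau>1) * (c * ((E z)\<^sup>2 - \<tau>2))" for z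
    using eq2[of z] xE2[of z] \<alpha>(1) sum prod by algebra
  moreover have "(E z)\<^sup>2 - \<tau>1 \<noteq> 0 \<or> c * ((E z)\<^sup>2 - \<tau>2) \<noteq> 0" for z
    using ne \<open>c \<noteq> 0\<close> by auto
  moreover have "2 * \<alpha> * E z0 * y2 z0 \<noteq> 0" using \<alpha> E0 z0 by simp
  moreover have holE: "E holomorphic_on UNIV" unfolding E_def by (intro holomorphic_intros hol)
  then have "(\<lambda>z. 2 * \<alpha> * E z * y2 z) holomorphic_on UNIV" "(\<lambda>z. (E z)\<^sup>2 - \<tau>1) holomorphic_on UNIV"
       "(\<lambda>z. c * ((E z)\<^sup>2 - \<tau>2)) holomorphic_on UNIV"
    by (intro holomorphic_intros hol; assumption)+
  ultimately obtain k where k: "k holomorphic_on UNIV" "\<And>z. (E z)\<^sup>2 - \<tau>1 = (k z)\<^sup>2"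
    using entire_coprime_factor_is_power[of "\<lambda>z. 2 * \<alpha> * E z * y2 z" "\<lambda>z. (E z)\<^sup>2 - \<tau>1" "\<lambda>z. c * ((E z)\<^sup>2 - \<tau>2)" 2 z0]
    by auto
  define \<sigma> where "\<sigma> = csqrt (- \<tau>1)"
  have \<sigma>: "\<sigma>\<^sup>2 = - \<tau>1" "\<sigma> \<noteq> 0" using \<open>\<tau>1 \<noteq> 0\<close> by (auto simp: \<sigma>_def)
  have "k z \<noteq> \<sigma>" "k z \<noteq> - \<sigma>" for z
    using k(2)[of z] \<sigma>(1) E0[of z] by auto
  then have "range k \<inter> {\<sigma>, - \<sigma>} = {}" by fastforce
  moreover have "\<sigma> \<noteq> - \<sigma>" using \<sigma>(2) by auto
  ultimately obtain \<gamma> where "k = (\<lambda>_. \<gamma>)"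
    using little_Picard[OF k(1)] by metis
  then have E2: "(E z)\<^sup>2 = \<gamma>\<^sup>2 + \<tau>1" for z using k(2)[of z] by (simp add: algebra_simps)
  moreover have "\<gamma>\<^sup>2 + \<tau>1 \<noteq> 0" using E0[of 0] E2[of 0] by auto
  moreover have "(x z)\<^sup>2 * (4 * a * (\<gamma>\<^sup>2 + \<tau>1)) = (\<gamma>\<^sup>2 + \<tau>1 - b)\<^sup>2" for z
    using xE2[of z] unfolding E2 by (simp only: mult_ac)
  ultimately have "(x z)\<^sup>2 = (\<gamma>\<^sup>2 + \<tau>1 - b)\<^sup>2 / (4 * a * (\<gamma>\<^sup>2 + \<tau>1))" for z
    using \<open>a \<noteq> 0\<close> by (subst nonzero_eq_divide_eq) auto
  then show ?thesis by blast
qed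

text \<open>
  Each \<open>1 - \<eta>^j g\<close> is an \<open>n\<close>-th power \<open>h_j^n\<close>, because the complementary factor of \<open>1 - g^m\<close> equals \<open>m\<close> where
  \<open>\<eta>^j g = 1\<close>.  Eliminating \<open>g\<close> leaves linear relations between the \<open>h_j^n\<close>.  For \<open>n \<ge> 3\<close> one relation between
  two of them is enough; for \<open>n = 2\<close> a conic admits nonconstant entire solutions, and the relations
  between three of them, available because \<open>m \<ge> 3\<close>, are used.
\<close>
lemma entire_fermat_equation_trivial:
  fixes f g :: "complex \<Rightarrow> complex"
  assumes hol: "f holomorphic_on UNIV" "g holomorphic_on UNIV"
    and nm: "n \<ge> 2" "m \<ge> 3" and eq: "\<And>z. f z ^ n + g z ^ m = 1"
  shows "g constant_on UNIV"
proof (cases "\<forall>z. f z = 0")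
  case True
  have "continuous_on UNIV g" using hol(2) by (rule holomorphic_on_imp_continuous_on)
  moreover have "finite (range g)"
  proof (rule finite_subset)
    show "range g \<subseteq> {w. w ^ m = 1}" using True eq nm by (auto simp: power_0_left)
    show "finite {w :: complex. w ^ m = 1}" using nm by (intro finite_roots_unity) auto
  qed
  ultimately show ?thesis by (intro continuous_finite_range_constant) auto
next
  case False
  then obtain z0 where z0: "f z0 \<noteq> 0" by blast
  obtain \<eta> :: complex where \<eta>: "\<eta> ^ m = 1" "\<eta> \<noteq> 0" "\<eta> \<noteq> 1" "\<eta>\<^sup>2 \<noteq> 1"
    using nm(2) by (rule primitive_root_of_unity)
  have "\<exists>h. h holomorphic_on UNIV \<and> (\<forall>z. 1 - \<eta> ^ j * g z = h z ^ n)" for j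
  proof -
    define G where "G = (\<lambda>z. \<Sum>i<m. (\<eta> ^ j * g z) ^ i)"
    have "f z ^ n = (1 - \<eta> ^ j * g z) * G z" for z
    proof -
      have "(\<eta> ^ j) ^ m = (\<eta> ^ m) ^ j" by (simp add: mult.commute flip: power_mult)
      then have "(\<eta> ^ j * g z) ^ m = g z ^ m" by (simp add: power_mult_distrib \<eta>(1))
      then have "f z ^ n = 1 - (\<eta> ^ j * g z) ^ m" using eq[of z] by (simp only: eq_diff_eq)
      then show ?thesis unfolding G_def by (simp only: one_diff_power_eq)
    qed
    moreover have "1 - \<eta> ^ j * g z \<noteq> 0 \<or> G z \<noteq> 0" for z
      using nm by (auto simp: G_def)
    moreover have "G holomorphic_on UNIV" "(\<lambda>z. 1 - \<eta> ^ j * g z) holomorphic_on UNIV"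
      unfolding G_def by (intro holomorphic_intros hol)+
    ultimately obtain h where "h holomorphic_on UNIV" "\<And>z. 1 - \<eta> ^ j * g z = h z ^ n"
      using entire_coprime_factor_is_power[of f "\<lambda>z. 1 - \<eta> ^ j * g z" G n z0] hol z0 nm by auto
    then show ?thesis by blast
  qed
  then obtain h where h: "\<And>j. h j holomorphic_on UNIV" "\<And>j z. 1 - \<eta> ^ j * g z = h j z ^ n"
    by metis
  have g: "g z = 1 - h 0 z ^ n" for z using h(2)[of 0 z] by (simp add: algebra_simps)
  have rel: "h j z ^ n = \<eta> ^ j * h 0 z ^ n + (1 - \<eta> ^ j)" for j z
    using h(2)[of j z] g[of z] by (simp add: algebra_simps)
  have "\<exists>C. \<forall>z. h 0 z ^ n = C"
  proof (cases "n = 2")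
    case True
    show ?thesis unfolding True
    proof (rule entire_intersecting_conics_const)
      show "(h 1 z)\<^sup>2 = \<eta> * (h 0 z)\<^sup>2 + (1 - \<eta>)" "(h 2 z)\<^sup>2 = \<eta>\<^sup>2 * (h 0 z)\<^sup>2 + (1 - \<eta>\<^sup>2)" for z
        using rel[of 1 z] rel[of 2 z] True by simp_all
      have "\<eta> * (1 - \<eta>\<^sup>2) - (1 - \<eta>) * \<eta>\<^sup>2 = \<eta> * (1 - \<eta>)"
        by (simp add: power2_eq_square algebra_simps)
      then show "\<eta> * (1 - \<eta>\<^sup>2) \<noteq> (1 - \<eta>) * \<eta>\<^sup>2" using \<eta> by auto
    qed (use h \<eta> in auto)
  next
    case False
    then have "n \<ge> 3" using nm by simp
    then show ?thesis
      using rel[of 1] \<eta> h(1) by (intro entire_power_plus_power_const[of "h 1" "h 0" n \<eta> "1 - \<eta>"]) auto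
  qed
  then show ?thesis unfolding constant_on_def g by auto
qed

section \<open>A meromorphic parametrization of the Fermat cubic\<close>

text \<open>
  If \<open>P0(u)\<close> is determined by \<open>P0(u/2)\<close> and \<open>P0(- u/2)\<close>, the right-hand side of this relation makes sense on the disc
  of radius \<open>2 r\<close>, and the extended function satisfies the same relation there; iterate.  Successive
  extensions agree only off their singularities, so they are compared after normalization by
  \<open>remove_sings\<close>, where the agreement is exact.
\<close>
lemma meromorphic_doubling_extension:
  fixes G :: "complex \<Rightarrow> complex \<Rightarrow> complex"
  assumes r: "r > 0" and P0: "P0 meromorphic_on ball 0 r"
    and G: "\<And>f g A. f meromorphic_on A \<Longrightarrow> g meromorphic_on A \<Longrightarrow> (\<lambda>w. G (f w) (g w)) meromorphic_on A"
    and base: "\<And>u. u \<in> ball 0 r - {0} \<Longrightarrow> P0 u = G (P0 (u / 2)) (P0 (- u / 2))"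
  obtains P where "P meromorphic_on UNIV" "\<And>u. u \<in> ball 0 r \<Longrightarrow> \<forall>\<^sub>F w in at u. P w = P0 w"
proof -
  define D where "D = (\<lambda>(f :: complex \<Rightarrow> complex) u. G (f (u / 2)) (f (- u / 2)))"
  define Q where "Q = (\<lambda>k. (D ^^ k) P0)"
  have QSuc: "Q (Suc k) = D (Q k)" for k by (simp add: Q_def)
  then have Qrec: "Q (Suc k) w = G (Q k (1/2 * w)) (Q k (-1/2 * w))" for k w
    by (simp add: D_def)
  have merQ: "Q k meromorphic_on ball 0 (2 ^ k * r)" for k
  proof (induction k)
    case 0
    then show ?case using P0 by (simp add: Q_def)
  next
    case (Suc k)
    have "(\<lambda>u. Q k (u / 2)) meromorphic_on ball 0 (2 ^ Suc k * r)"
         "(\<lambda>u. Q k (- u / 2)) meromorphic_on ball 0 (2 ^ Suc k * r)"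
      by (rule meromorphic_on_compose[OF Suc]; force intro!: analytic_intros simp: norm_divide)+
    then show ?case unfolding QSuc D_def by (rule G)
  qed
  have lim: "filterlim (\<lambda>w. a * w) (at (a * u)) (at u)" if "a \<noteq> 0" for a u :: complex
    unfolding filterlim_at using that
    by (auto intro!: tendsto_intros simp: eventually_at_filter)
  have step: "\<forall>\<^sub>F w in at u. Q (Suc k) w = Q k w" if "u \<in> ball 0 (2 ^ k * r)" for k u
    using that
  proof (induction k arbitrary: u)
    case 0
    then have "\<forall>\<^sub>F w in at u. w \<in> ball 0 r - {0}"
      using eventually_at_in_open'[of "ball 0 r" u] eventually_neq_at_within[of 0 u UNIV]
      by (auto elim: eventually_elim2)
    then show ?case
      unfolding QSuc by eventually_elim (use base in \<open>auto simp: Q_def D_def\<close>)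
  next
    case (Suc k)
    have "\<forall>\<^sub>F w in at (a * u). Q (Suc k) w = Q k w" if "a = 1/2 \<or> a = -1/2" for a
    proof (rule Suc.IH)
      have "cmod a = 1 / 2" using that by (elim disjE) (simp_all only: norm_divide norm_one norm_numeral norm_minus_cancel)
      then have "cmod (a * u) = cmod u / 2" by (simp add: norm_mult)
      then show "a * u \<in> ball 0 (2 ^ k * r)" using Suc.prems by simp
    qed
    then have "\<forall>\<^sub>F w in at u. Q (Suc k) (a * w) = Q k (a * w)" if "a = 1/2 \<or> a = -1/2" for a
      using that by (intro eventually_compose_filterlim[OF _ lim]) auto
    from this[of "1/2"] this[of "-1/2"]
    have "\<forall>\<^sub>F w in at u. Q (Suc k) (1/2 * w) = Q k (1/2 * w)"
         "\<forall>\<^sub>F w in at u. Q (Suc k) (-1/2 * w) = Q k (-1/2 * w)"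
      by blast+
    then show ?case
      by eventually_elim (metis Qrec)
  qed
  define N where "N = (\<lambda>k. remove_sings (Q k))"
  have N_eq: "N l u = N k u" if "u \<in> ball 0 (2 ^ k * r)" "k \<le> l" for k l u
    using that(2)
  proof (induction l rule: dec_induct)
    case (step l)
    have "2 ^ k * r \<le> 2 ^ l * r" using step r by (intro mult_right_mono power_increasing) auto
    then have "u \<in> ball 0 (2 ^ l * r)" using that(1) by auto
    then have "N (Suc l) u = N l u" unfolding N_def by (intro remove_sings_cong refl assms \<open>\<And>u k. u \<in> ball 0 (2 ^ k * r) \<Longrightarrow> \<forall>\<^sub>F w in at u. Q (Suc k) w = Q k w\<close>)
    with step show ?case by simp
  qed simp
  have "\<exists>k. u \<in> ball 0 (2 ^ k * r)" for u :: complex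
  proof -
    obtain k where "norm u / r < 2 ^ k" using real_arch_pow[of 2 "norm u / r"] by auto
    then show ?thesis using r by (auto simp: field_simps)
  qed
  then obtain K where K: "\<And>u::complex. u \<in> ball 0 (2 ^ K u * r)" by metis
  define P where "P = (\<lambda>u. N (K u) u)"
  have P_eq: "P u = N k u" if "u \<in> ball 0 (2 ^ k * r)" for u k
    using N_eq[OF that] N_eq[OF K[of u]] by (metis P_def nle_le)
  have ev: "\<forall>\<^sub>F w in at u. P w = Q k w" if "u \<in> ball 0 (2 ^ k * r)" for u k
  proof -
    have "Q k meromorphic_on {u}" using merQ by (rule meromorphic_on_subset) (use that in auto)
    then have "\<forall>\<^sub>F w in at u. N k w = Q k w"
      unfolding N_def by (intro eventually_remove_sings_eq_at meromorphic_on_isolated_singularity)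
    moreover have "\<forall>\<^sub>F w in at u. w \<in> ball 0 (2 ^ k * r)"
      using that by (intro eventually_at_in_open') auto
    ultimately show ?thesis by eventually_elim (use P_eq in auto)
  qed
  show ?thesis
  proof (rule that)
    show "\<forall>\<^sub>F w in at u. P w = P0 w" if "u \<in> ball 0 r" for u
      using ev[of u 0] that by (simp add: Q_def)
    have "P meromorphic_on {u}" for u
    proof -
      have "Q (K u) meromorphic_on {u}"
        using K by (intro meromorphic_on_subset[OF merQ[of "K u"]]) blast
      moreover have "P meromorphic_on {u} \<longleftrightarrow> Q (K u) meromorphic_on {u}"
        by (rule meromorphic_on_cong) (use ev[OF K] in auto)
      ultimately show ?thesis by blast
    qed
    then show "P meromorphic_on UNIV"
      by (subst meromorphic_on_meromorphic_at) blast
  qed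
qed

text \<open>
  Near \<open>1\<close> the principal cube root inverts cubing; this identifies values of \<open>fermat_y\<close> below from their cubes.
\<close>
lemma cube_root_near_1:
  "\<forall>\<^sub>F w :: complex in nhds 1. exp (Ln (w ^ 3) / 3) = w"
proof -
  have "((\<lambda>w. Im (Ln w)) \<longlongrightarrow> Im (Ln 1)) (nhds 1)"
    by (intro tendsto_intros filterlim_ident) auto
  then have lim: "((\<lambda>w. Im (Ln w)) \<longlongrightarrow> 0) (nhds 1)" by simp
  have "\<forall>\<^sub>F w in nhds 1. Im (Ln w) < pi / 3" "\<forall>\<^sub>F w in nhds 1. - pi / 3 < Im (Ln w)"
    by (rule order_tendstoD[OF lim]; simp)+
  moreover have "\<forall>\<^sub>F w :: complex in nhds 1. w \<in> - {0}"
    by (intro eventually_nhds_in_open) auto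
  ultimately show ?thesis
  proof eventually_elim
    case (elim w)
    have "exp (3 * Ln w) = w ^ 3" using elim(3) exp_of_nat_mult[of 3 "Ln w"] by simp
    then have "Ln (w ^ 3) = 3 * Ln w" using elim by (intro Ln_unique) auto
    then show ?case using elim(3) by simp
  qed
qed

text \<open>
  On the Fermat cubic \<open>x^3 + y^3 = 1\<close> take the flex \<open>(0, 1)\<close> as origin and \<open>x = s\<close> as local coordinate; the other
  coordinate is the following branch \<open>y = fermat_y s\<close>.  In this chart duplication sends \<open>(s, y)\<close> to
  \<open>(s (1 + y^3), y^3 - s^3) / (y (1 + s^3))\<close>, where \<open>1 + y^3 = 2 - s^3\<close> and \<open>y^3 - s^3 = 1 - 2 s^3\<close>, and negation
  sends it to \<open>(- s / y, 1 / y)\<close>.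
\<close>
definition fermat_y :: "complex \<Rightarrow> complex" where
  "fermat_y s = exp (Ln (1 - s ^ 3) / 3)"

definition fermat_dup :: "complex \<Rightarrow> complex" where
  "fermat_dup s = s * (2 - s ^ 3) / (fermat_y s * (1 + s ^ 3))"

definition fermat_dup_y :: "complex \<Rightarrow> complex" where
  "fermat_dup_y s = (1 - 2 * s ^ 3) / (fermat_y s * (1 + s ^ 3))"

definition fermat_neg :: "complex \<Rightarrow> complex" where
  "fermat_neg s = - s / fermat_y s"

lemma fermat_y_0 [simp]: "fermat_y 0 = 1" by (simp add: fermat_y_def)

lemma fermat_y_nz [simp]: "fermat_y s \<noteq> 0" by (simp add: fermat_y_def)

lemma one_minus_cube_Re_pos: "Re (1 - s ^ 3) > 0" if "s \<in> ball 0 1" for s :: complex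
proof -
  have "cmod (s ^ 3) < 1" using that power_less_one_iff[of "cmod s" 3] by (simp add: norm_power)
  then have "Re (s ^ 3) < 1" using complex_Re_le_cmod[of "s ^ 3"] by linarith
  then show ?thesis by simp
qed

lemma fermat_y_cubed: "fermat_y s ^ 3 = 1 - s ^ 3" if "s \<in> ball 0 1"
proof -
  have "1 - s ^ 3 \<noteq> 0" using one_minus_cube_Re_pos[OF that] by force
  moreover have "fermat_y s ^ 3 = exp (Ln (1 - s ^ 3))" unfolding fermat_y_def exp_of_nat_mult[symmetric] by simp
  ultimately show ?thesis by (simp only: exp_Ln not_False_eq_True)
qed

lemma fermat_y_deriv: "(fermat_y has_field_derivative - s\<^sup>2 / (fermat_y s)\<^sup>2) (at s)" if "s \<in> ball 0 1"
proof -
  have "((\<lambda>s. Ln (1 - s ^ 3)) has_field_derivative - (3 * s\<^sup>2) / (1 - s ^ 3)) (at s)"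
    using one_minus_cube_Re_pos[OF that]
    by (auto intro!: derivative_eq_intros simp: complex_nonpos_Reals_iff divide_inverse)
  from DERIV_fun_exp[OF DERIV_cdivide[OF this, of 3]] have "(fermat_y has_field_derivative fermat_y s * (- (3 * s\<^sup>2) / (1 - s ^ 3) / 3)) (at s)"
    by (simp only: fermat_y_def[abs_def])
  also have "fermat_y s * (- (3 * s\<^sup>2) / (1 - s ^ 3) / 3) = - s\<^sup>2 / (fermat_y s)\<^sup>2"
    unfolding fermat_y_cubed[OF that, symmetric] by (simp add: field_simps eval_nat_numeral)
  finally show ?thesis .
qed

lemma fermat_y_tendsto: "(fermat_y \<longlongrightarrow> 1) (nhds 0)"
proof -
  have "isCont fermat_y 0" using fermat_y_deriv[of 0] by (intro DERIV_isCont) auto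
  then show ?thesis unfolding isCont_def tendsto_at_iff_tendsto_nhds by simp
qed

text \<open>
  The values \<open>fermat_y (fermat_dup s)\<close> and \<open>fermat_dup_y s\<close> have the same cube by the equation of the curve,
  and both tend to \<open>1\<close> as \<open>s\<close> tends to \<open>0\<close>, so they cannot differ by a nontrivial cube root of unity.
\<close>
lemma fermat_y_dup: "\<forall>\<^sub>F s in nhds 0. fermat_dup s \<in> ball 0 1 \<and> 1 + s ^ 3 \<noteq> 0 \<and> s \<in> ball 0 1 \<and> fermat_y (fermat_dup s) = fermat_dup_y s \<and> fermat_dup_y s \<noteq> 0"
proof -
  have "((\<lambda>s. s * (2 - s ^ 3) / (fermat_y s * (1 + s ^ 3))) \<longlongrightarrow> 0 * (2 - 0 ^ 3) / (1 * (1 + 0 ^ 3))) (nhds 0)"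
    by (intro tendsto_intros fermat_y_tendsto filterlim_ident) auto
  then have d: "(fermat_dup \<longlongrightarrow> 0) (nhds 0)" by (simp add: fermat_dup_def[abs_def])
  have "((\<lambda>s. (1 - 2 * s ^ 3) / (fermat_y s * (1 + s ^ 3))) \<longlongrightarrow> (1 - 2 * 0 ^ 3) / (1 * (1 + 0 ^ 3))) (nhds 0)"
    by (intro tendsto_intros fermat_y_tendsto filterlim_ident) auto
  then have e: "(fermat_dup_y \<longlongrightarrow> 1) (nhds 0)" by (simp add: fermat_dup_y_def[abs_def])
  have e1: "\<forall>\<^sub>F s in nhds 0. fermat_dup_y s \<in> - {0}"
    by (rule topological_tendstoD[OF e]) auto
  have d1: "\<forall>\<^sub>F s in nhds 0. fermat_dup s \<in> ball 0 1"
    by (rule topological_tendstoD[OF d]) auto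
  have "((\<lambda>s::complex. 1 + s ^ 3) \<longlongrightarrow> 1 + 0 ^ 3) (nhds 0)"
    by (intro tendsto_intros filterlim_ident)
  then have o: "\<forall>\<^sub>F s :: complex in nhds 0. 1 + s ^ 3 \<in> - {0}"
    by (rule topological_tendstoD) auto
  have b: "\<forall>\<^sub>F s in nhds 0. s \<in> ball (0::complex) 1"
    by (intro eventually_nhds_in_open) auto
  from eventually_compose_filterlim[OF cube_root_near_1 e] e1 d1 o b
  show ?thesis
  proof eventually_elim
    case (elim s)
    have cs: "fermat_y s ^ 3 = 1 - s ^ 3" using elim fermat_y_cubed by blast
    have nz: "fermat_y s * (1 + s ^ 3) \<noteq> 0" using elim by simp
    have "(fermat_y s * (1 + s ^ 3)) ^ 3 - (s * (2 - s ^ 3)) ^ 3 = (1 - 2 * s ^ 3) ^ 3"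
      using cs by algebra
    then have "1 - fermat_dup s ^ 3 = fermat_dup_y s ^ 3"
      using nz unfolding fermat_dup_def fermat_dup_y_def power_divide by (simp add: divide_simps)
    then have "fermat_y (fermat_dup s) = fermat_dup_y s" using elim(1) by (simp add: fermat_y_def)
    then show ?case using elim by simp
  qed
qed

lemma fermat_y_neg: "\<forall>\<^sub>F s in nhds 0. fermat_neg s \<in> ball 0 1 \<and> s \<in> ball 0 1 \<and> fermat_y (fermat_neg s) = 1 / fermat_y s"
proof -
  have "((\<lambda>s. - s / fermat_y s) \<longlongrightarrow> - 0 / 1) (nhds 0)"
    by (intro tendsto_intros fermat_y_tendsto filterlim_ident) auto
  then have d: "(fermat_neg \<longlongrightarrow> 0) (nhds 0)" by (simp add: fermat_neg_def[abs_def])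
  have "((\<lambda>s. 1 / fermat_y s) \<longlongrightarrow> 1 / 1) (nhds 0)"
    by (intro tendsto_intros fermat_y_tendsto filterlim_ident) auto
  then have e: "((\<lambda>s. 1 / fermat_y s) \<longlongrightarrow> 1) (nhds 0)" by simp
  have d1: "\<forall>\<^sub>F s in nhds 0. fermat_neg s \<in> ball 0 1"
    by (rule topological_tendstoD[OF d]) auto
  have b: "\<forall>\<^sub>F s in nhds 0. s \<in> ball (0::complex) 1"
    by (intro eventually_nhds_in_open) auto
  from eventually_compose_filterlim[OF cube_root_near_1 e] d1 b
  show ?thesis
  proof eventually_elim
    case (elim s)
    have cs: "fermat_y s ^ 3 = 1 - s ^ 3" using elim fermat_y_cubed by blast
    have "s ^ 3 \<noteq> 1"
    proof
      assume "s ^ 3 = 1"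
      with cs have "fermat_y s ^ 3 = 0" by simp
      then show False by simp
    qed
    then have "1 - fermat_neg s ^ 3 = (1 / fermat_y s) ^ 3"
      using cs unfolding fermat_neg_def power_divide by (simp add: divide_simps)
    then have "fermat_y (fermat_neg s) = 1 / fermat_y s" using elim(1) by (simp add: fermat_y_def)
    then show ?case using elim by simp
  qed
qed

lemma deriv_zero_on_ball_imp_const:
  fixes h :: "complex \<Rightarrow> complex"
  assumes "\<And>s. s \<in> ball 0 \<delta> \<Longrightarrow> (h has_field_derivative 0) (at s)" "s \<in> ball 0 \<delta>"
  shows "h s = h 0"
proof -
  have "\<exists>k. \<forall>s\<in>ball 0 \<delta>. h s = k"
    by (rule has_field_derivative_zero_constant)
       (auto intro!: assms has_field_derivative_at_within[OF assms(1)])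
  moreover have "0 \<in> ball (0::complex) \<delta>" using assms(2) le_less_trans[OF norm_ge_zero[of s], of \<delta>] by simp
  ultimately show ?thesis using assms(2) by metis
qed

text \<open>
  The group law is linearized by the integral of the invariant differential \<open>dx / y^2\<close> of the cubic, which
  duplication doubles and negation negates.  Both facts are checked on derivatives.
\<close>
lemma abelian_integral_dup:
  assumes \<Phi>: "\<And>s. s \<in> ball 0 1 \<Longrightarrow> (\<Phi> has_field_derivative 1 / (fermat_y s)\<^sup>2) (at s)"
    and \<Phi>0: "\<Phi> 0 = 0"
  shows "\<forall>\<^sub>F s in nhds 0. \<Phi> (fermat_dup s) = 2 * \<Phi> s"
proof -
  obtain \<delta> where \<delta>: "\<delta> > 0" "\<And>s. s \<in> ball 0 \<delta> \<Longrightarrow> fermat_dup s \<in> ball 0 1 \<and> 1 + s ^ 3 \<noteq> 0 \<and> s \<in> ball 0 1 \<and> fermat_y (fermat_dup s) = fermat_dup_y s \<and> fermat_dup_y s \<noteq> 0"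
    using fermat_y_dup unfolding eventually_nhds_metric by (auto simp: dist_commute)
  have "((\<lambda>s. \<Phi> (fermat_dup s) - 2 * \<Phi> s) has_field_derivative 0) (at s)" if s: "s \<in> ball 0 \<delta>" for s
  proof -
    note sd = \<delta>(2)[OF s]
    have cs: "fermat_y s ^ 3 = 1 - s ^ 3" using sd fermat_y_cubed by blast
    define C where "C = fermat_y s"
    have C: "C \<noteq> 0" "C ^ 3 = 1 - s ^ 3" using cs by (auto simp: C_def)
    have nz: "1 + s ^ 3 \<noteq> 0" using sd by blast
    have "(fermat_dup has_field_derivative 2 * (fermat_dup_y s)\<^sup>2 / (fermat_y s)\<^sup>2) (at s)"
    proof -
      have "(fermat_dup has_field_derivative
              ((2 - 4 * s ^ 3) * (C * (1 + s ^ 3)) -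
                s * (2 - s ^ 3) * ((- s\<^sup>2 / C\<^sup>2) * (1 + s ^ 3) + C * (3 * s\<^sup>2))) / (C * (1 + s ^ 3))\<^sup>2) (at s)"
      proof -
        have num: "((\<lambda>s. s * (2 - s ^ 3)) has_field_derivative (2 - 4 * s ^ 3)) (at s)"
          by (auto intro!: derivative_eq_intros simp: algebra_simps eval_nat_numeral)
        have one: "((\<lambda>s. 1 + s ^ 3) has_field_derivative 3 * s\<^sup>2) (at s)"
          by (auto intro!: derivative_eq_intros)
        have den: "((\<lambda>s. fermat_y s * (1 + s ^ 3)) has_field_derivative
                     ((- s\<^sup>2 / C\<^sup>2) * (1 + s ^ 3) + C * (3 * s\<^sup>2))) (at s)"
          using DERIV_mult'[OF fermat_y_deriv one] sd by (simp add: C_def add.commute)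
        show ?thesis
          using DERIV_divide[OF num den] C(1) nz
          by (simp add: C_def power2_eq_square flip: fermat_dup_def)
      qed
      also have "(2 - 4 * s ^ 3) * (C * (1 + s ^ 3)) -
                s * (2 - s ^ 3) * ((- s\<^sup>2 / C\<^sup>2) * (1 + s ^ 3) + C * (3 * s\<^sup>2))
               = 2 * (1 - 2 * s ^ 3)\<^sup>2 / C\<^sup>2"
      proof -
        have "C\<^sup>2 * ((2 - 4 * s ^ 3) * (C * (1 + s ^ 3))) -
                s * (2 - s ^ 3) * ((- s\<^sup>2) * (1 + s ^ 3) + C\<^sup>2 * C * (3 * s\<^sup>2))
               = 2 * (1 - 2 * s ^ 3)\<^sup>2"
          using C(2) by algebra
        then show ?thesis using C(1) by (simp add: field_simps)
      qed
      also have "2 * (1 - 2 * s ^ 3)\<^sup>2 / C\<^sup>2 / (C * (1 + s ^ 3))\<^sup>2 = 2 * (fermat_dup_y s)\<^sup>2 / (fermat_y s)\<^sup>2"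
        by (simp add: fermat_dup_y_def C_def power_divide)
      finally show ?thesis .
    qed
    from DERIV_chain2[OF \<Phi> this] sd
    have "((\<lambda>s. \<Phi> (fermat_dup s)) has_field_derivative 1 / (fermat_dup_y s)\<^sup>2 * (2 * (fermat_dup_y s)\<^sup>2 / (fermat_y s)\<^sup>2)) (at s)"
      by simp
    then have "((\<lambda>s. \<Phi> (fermat_dup s)) has_field_derivative 2 * (1 / (fermat_y s)\<^sup>2)) (at s)" using sd by simp
    from DERIV_diff[OF this DERIV_cmult[OF \<Phi>, of s 2]] sd show ?thesis by simp
  qed
  then have "\<Phi> (fermat_dup s) - 2 * \<Phi> s = \<Phi> (fermat_dup 0) - 2 * \<Phi> 0" if "s \<in> ball 0 \<delta>" for s
    using deriv_zero_on_ball_imp_const[of \<delta> _ s] that by blast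
  then have "\<forall>s\<in>ball 0 \<delta>. \<Phi> (fermat_dup s) = 2 * \<Phi> s" by (auto simp: \<Phi>0 fermat_dup_def)
  with \<delta>(1) show ?thesis unfolding eventually_nhds_metric by (auto simp: dist_commute)
qed

lemma abelian_integral_neg:
  assumes \<Phi>: "\<And>s. s \<in> ball 0 1 \<Longrightarrow> (\<Phi> has_field_derivative 1 / (fermat_y s)\<^sup>2) (at s)"
    and \<Phi>0: "\<Phi> 0 = 0"
  shows "\<forall>\<^sub>F s in nhds 0. \<Phi> (fermat_neg s) = - \<Phi> s"
proof -
  obtain \<delta> where \<delta>: "\<delta> > 0" "\<And>s. s \<in> ball 0 \<delta> \<Longrightarrow> fermat_neg s \<in> ball 0 1 \<and> s \<in> ball 0 1 \<and> fermat_y (fermat_neg s) = 1 / fermat_y s"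
    using fermat_y_neg unfolding eventually_nhds_metric by (auto simp: dist_commute)
  have "((\<lambda>s. \<Phi> (fermat_neg s) + \<Phi> s) has_field_derivative 0) (at s)" if s: "s \<in> ball 0 \<delta>" for s
  proof -
    note sd = \<delta>(2)[OF s]
    have cs: "fermat_y s ^ 3 = 1 - s ^ 3" using sd fermat_y_cubed by blast
    have "(fermat_neg has_field_derivative (- 1 * fermat_y s - (- s) * (- s\<^sup>2 / (fermat_y s)\<^sup>2)) / (fermat_y s * fermat_y s)) (at s)"
      unfolding fermat_neg_def[abs_def] using sd by (intro DERIV_divide derivative_intros fermat_y_deriv) auto
    also have "- 1 * fermat_y s - (- s) * (- s\<^sup>2 / (fermat_y s)\<^sup>2) = - 1 / (fermat_y s)\<^sup>2"
    proof -
      have "fermat_y s * (fermat_y s)\<^sup>2 + s * s\<^sup>2 = 1" using cs by algebra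
      then have "(- 1 * fermat_y s - (- s) * (- s\<^sup>2 / (fermat_y s)\<^sup>2)) * (fermat_y s)\<^sup>2 = - 1"
        by (simp add: left_diff_distrib algebra_simps)
      then show ?thesis by (subst nonzero_eq_divide_eq) simp_all
    qed
    finally have "(fermat_neg has_field_derivative - 1 / (fermat_y s)\<^sup>2 / (fermat_y s * fermat_y s)) (at s)" .
    from DERIV_chain2[OF \<Phi> this] sd
    have "((\<lambda>s. \<Phi> (fermat_neg s)) has_field_derivative 1 / (1 / fermat_y s)\<^sup>2 * (- 1 / (fermat_y s)\<^sup>2 / (fermat_y s * fermat_y s))) (at s)"
      by simp
    then have "((\<lambda>s. \<Phi> (fermat_neg s)) has_field_derivative - (1 / (fermat_y s)\<^sup>2)) (at s)"
      by (simp add: power2_eq_square)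
    from DERIV_add[OF this \<Phi>] sd show ?thesis by simp
  qed
  then have "\<Phi> (fermat_neg s) + \<Phi> s = \<Phi> (fermat_neg 0) + \<Phi> 0" if "s \<in> ball 0 \<delta>" for s
    using deriv_zero_on_ball_imp_const[of \<delta> _ s] that by blast
  then have "\<forall>s\<in>ball 0 \<delta>. \<Phi> (fermat_neg s) = - \<Phi> s" by (auto simp: \<Phi>0 fermat_neg_def add_eq_0_iff)
  with \<delta>(1) show ?thesis unfolding eventually_nhds_metric by (auto simp: dist_commute)
qed

lemma abelian_integral_exists:
  obtains \<Phi> where "\<And>s. s \<in> ball 0 1 \<Longrightarrow> (\<Phi> has_field_derivative 1 / (fermat_y s)\<^sup>2) (at s)" "\<Phi> 0 = 0"
proof -
  have np: "1 - s ^ 3 \<notin> \<real>\<^sub>\<le>\<^sub>0" if "s \<in> ball 0 1" for s :: complex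
    using one_minus_cube_Re_pos[OF that] by (auto simp: complex_nonpos_Reals_iff)
  have "(\<lambda>s. 1 / (fermat_y s)\<^sup>2) holomorphic_on ball 0 1"
    unfolding fermat_y_def using np by (intro holomorphic_intros) auto
  then obtain F where F: "\<And>s. s \<in> ball 0 1 \<Longrightarrow>
      (F has_field_derivative 1 / (fermat_y s)\<^sup>2) (at s within ball 0 1)"
    using holomorphic_convex_primitive'[of "ball 0 1" "\<lambda>s. 1 / (fermat_y s)\<^sup>2"] by auto
  show ?thesis
  proof (rule that[of "\<lambda>s. F s - F 0"])
    fix s :: complex assume s: "s \<in> ball 0 1"
    have "(F has_field_derivative 1 / (fermat_y s)\<^sup>2) (at s)"
      using F[OF s] s by (simp add: at_within_open[of s "ball 0 1"])
    then show "((\<lambda>s. F s - F 0) has_field_derivative 1 / (fermat_y s)\<^sup>2) (at s)"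
      by (auto intro!: derivative_eq_intros)
  qed simp
qed

text \<open>
  The local inverse \<open>\<psi>\<close> of the abelian integral turns doubling and negation of \<open>u\<close> into duplication and negation
  on the curve.  With \<open>s = \<psi> u\<close> the function \<open>1 / \<psi>\<close> takes the values \<open>1 / s\<close> at \<open>u\<close> and \<open>- y / s\<close> at \<open>- u\<close>, which
  again satisfy the equation of the cubic because \<open>y^3 = 1 - s^3\<close>; this projective change of coordinates moves
  the origin to a flex at infinity, where negation becomes the exchange of the two coordinates.
  The last equation is the duplication formula in these coordinates.
\<close>
lemma fermat_cubic_local_parametrization:
  obtains \<psi> r where "r > 0" "\<psi> holomorphic_on ball 0 r" "\<psi> 0 = 0"
    "\<And>u. u \<in> ball 0 r - {0} \<Longrightarrow> \<psi> u \<noteq> 0"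
    "\<And>u. u \<in> ball 0 r - {0} \<Longrightarrow> (1 / \<psi> u) ^ 3 + (1 / \<psi> (- u)) ^ 3 = 1"
    "\<And>u. u \<in> ball 0 r - {0} \<Longrightarrow> 1 / \<psi> u =
       (1 / \<psi> (- u / 2)) * ((1 / \<psi> (u / 2)) ^ 3 + 1) / ((1 / \<psi> (- u / 2)) ^ 3 - (1 / \<psi> (u / 2)) ^ 3)"
proof -
  obtain \<Phi> where \<Phi>: "\<And>s. s \<in> ball 0 1 \<Longrightarrow> (\<Phi> has_field_derivative 1 / (fermat_y s)\<^sup>2) (at s)" "\<Phi> 0 = 0"
    by (rule abelian_integral_exists) blast
  have hol: "\<Phi> holomorphic_on ball 0 1"
    unfolding holomorphic_on_open[OF open_ball] using \<Phi>(1) by blast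
  have deriv0: "deriv \<Phi> 0 \<noteq> 0" using \<Phi>(1)[of 0] by (simp add: DERIV_imp_deriv)
  obtain \<rho> where \<rho>: "\<rho> > 0" "ball (0::complex) \<rho> \<subseteq> ball 0 1" "inj_on \<Phi> (ball 0 \<rho>)"
    by (rule has_complex_derivative_locally_injective[OF hol _ open_ball deriv0]) auto
  define U where "U = ball (0::complex) \<rho>"
  have holU: "\<Phi> holomorphic_on U" "open U" "inj_on \<Phi> U"
    using hol \<rho> by (auto simp: U_def intro: holomorphic_on_subset)
  obtain \<psi> where \<psi>: "\<psi> holomorphic_on \<Phi> ` U" "\<And>s. s \<in> U \<Longrightarrow> \<psi> (\<Phi> s) = s"
    using holomorphic_has_inverse[OF holU] by metis
  have openV: "open (\<Phi> ` U)" using holU by (rule open_mapping_thm3)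
  have "0 \<in> U" using \<rho> by (simp add: U_def)
  then have 0: "0 \<in> \<Phi> ` U" "\<psi> 0 = 0" using \<Phi>(2) \<psi>(2)[of 0] by (auto intro: rev_image_eqI)
  have \<Phi>\<psi>: "\<Phi> (\<psi> u) = u \<and> \<psi> u \<in> U" if "u \<in> \<Phi> ` U" for u
    using that \<psi>(2) by auto
  have "isCont \<psi> 0"
    using \<psi>(1) 0 openV by (meson holomorphic_on_imp_continuous_on continuous_on_eq_continuous_at)
  then have \<psi>lim: "(\<psi> \<longlongrightarrow> 0) (nhds 0)"
    unfolding isCont_def tendsto_at_iff_tendsto_nhds by (simp add: 0)
  have inU: "\<forall>\<^sub>F s in nhds 0. s \<in> U" using holU(2) \<open>0 \<in> U\<close> by (rule eventually_nhds_in_open)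
  have inV: "\<forall>\<^sub>F u in nhds 0. u \<in> \<Phi> ` U" using openV 0(1) by (rule eventually_nhds_in_open)
  have lim0: "((\<lambda>s. s / fermat_y s) \<longlongrightarrow> 0 / 1) (nhds 0)"
             "((\<lambda>s. s * (2 - s ^ 3) / (fermat_y s * (1 + s ^ 3))) \<longlongrightarrow> 0 * (2 - 0 ^ 3) / (1 * (1 + 0 ^ 3))) (nhds 0)"
    by (intro tendsto_intros fermat_y_tendsto filterlim_ident; simp)+
  have neg_lim: "(fermat_neg \<longlongrightarrow> 0) (nhds 0)"
    using tendsto_minus[OF lim0(1)] by (simp add: fermat_neg_def[abs_def])
  have dup_lim: "(fermat_dup \<longlongrightarrow> 0) (nhds 0)"
    using lim0(2) by (simp add: fermat_dup_def[abs_def])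
  have dup: "\<forall>\<^sub>F s in nhds 0. \<Phi> (fermat_dup s) = 2 * \<Phi> s"
    by (rule abelian_integral_dup) (fact \<Phi>)+
  have neg: "\<forall>\<^sub>F s in nhds 0. \<Phi> (fermat_neg s) = - \<Phi> s"
    by (rule abelian_integral_neg) (fact \<Phi>)+
  have "\<forall>\<^sub>F s in nhds 0. fermat_neg s \<in> U \<and> fermat_dup s \<in> U \<and> \<Phi> (fermat_dup s) = 2 * \<Phi> s \<and>
          \<Phi> (fermat_neg s) = - \<Phi> s \<and> 1 + s ^ 3 \<noteq> 0 \<and> s \<in> ball 0 1"
    using eventually_compose_filterlim[OF inU neg_lim] eventually_compose_filterlim[OF inU dup_lim]
      dup neg fermat_y_dup
    by eventually_elim auto
  from inV eventually_compose_filterlim[OF this \<psi>lim]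
  have "\<forall>\<^sub>F u in nhds 0. u \<in> \<Phi> ` U \<and> \<psi> (2 * u) = fermat_dup (\<psi> u) \<and> \<psi> (- u) = fermat_neg (\<psi> u) \<and>
          1 + \<psi> u ^ 3 \<noteq> 0 \<and> \<psi> u \<in> ball 0 1"
  proof eventually_elim
    case (elim u)
    have "\<Phi> (fermat_dup (\<psi> u)) = 2 * u" "\<Phi> (fermat_neg (\<psi> u)) = - u"
      using elim \<Phi>\<psi>[of u] by auto
    then have "\<psi> (2 * u) = fermat_dup (\<psi> u)" "\<psi> (- u) = fermat_neg (\<psi> u)"
      using \<psi>(2)[of "fermat_dup (\<psi> u)"] \<psi>(2)[of "fermat_neg (\<psi> u)"] elim by auto
    with elim show ?case by auto
  qed
  then obtain r where r: "r > 0" and near: "\<And>u. u \<in> ball 0 r \<Longrightarrow> u \<in> \<Phi> ` U \<and> \<psi> (2 * u) = fermat_dup (\<psi> u) \<and>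
      \<psi> (- u) = fermat_neg (\<psi> u) \<and> 1 + \<psi> u ^ 3 \<noteq> 0 \<and> \<psi> u \<in> ball 0 1"
    unfolding eventually_nhds_metric by (auto simp: dist_commute)
  have nz: "\<psi> u \<noteq> 0" if "u \<in> ball 0 r - {0}" for u
    using \<Phi>\<psi>[of u] near[of u] that \<Phi>(2) by auto
  show ?thesis
  proof (rule that[OF r])
    show "\<psi> holomorphic_on ball 0 r" using \<psi>(1) by (rule holomorphic_on_subset) (use near in blast)
    show "\<psi> 0 = 0" by fact
    show "\<psi> u \<noteq> 0" if "u \<in> ball 0 r - {0}" for u using nz[OF that] .
    show "(1 / \<psi> u) ^ 3 + (1 / \<psi> (- u)) ^ 3 = 1" if "u \<in> ball 0 r - {0}" for u
    proof -
      define s where "s = \<psi> u"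
      have *: "\<psi> (- u) = - s / fermat_y s" "fermat_y s ^ 3 = 1 - s ^ 3" "s \<noteq> 0"
        using near[of u] nz[OF that] that fermat_y_cubed[of s] by (auto simp: s_def fermat_neg_def)
      then have "(1 / \<psi> (- u)) ^ 3 = - (1 - s ^ 3) / s ^ 3" by (simp add: power_divide diff_divide_distrib)
      also have "(1 / \<psi> u) ^ 3 + \<dots> = s ^ 3 / s ^ 3"
        unfolding s_def[symmetric] power_divide by (simp add: field_simps)
      finally show ?thesis using *(3) by simp
    qed
    show "1 / \<psi> u = (1 / \<psi> (- u / 2)) * ((1 / \<psi> (u / 2)) ^ 3 + 1) / ((1 / \<psi> (- u / 2)) ^ 3 - (1 / \<psi> (u / 2)) ^ 3)"
      if "u \<in> ball 0 r - {0}" for u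
    proof -
      define s y where "s = \<psi> (u / 2)" and "y = fermat_y s"
      have u2: "u / 2 \<in> ball 0 r - {0}" using that r by (auto simp: norm_divide)
      have s0: "s \<noteq> 0" and y0: "y \<noteq> 0" using nz[OF u2] by (auto simp: s_def y_def)
      have y3: "y ^ 3 = 1 - s ^ 3"
        using near[of "u / 2"] u2 fermat_y_cubed[of s] by (auto simp: s_def y_def)
      have neg: "\<psi> (- u / 2) = - s / y"
        using near[of "u / 2"] u2 by (auto simp: s_def y_def fermat_neg_def)
      have dup: "\<psi> u = s * (2 - s ^ 3) / (y * (1 + s ^ 3))"
        using near[of "u / 2"] u2 by (auto simp: s_def y_def fermat_dup_def)
      have s3: "s ^ 3 \<noteq> 2" using nz[OF that] dup by auto
      have 1: "(1 / (- s / y)) ^ 3 - (1 / s) ^ 3 = (s ^ 3 - 2) / s ^ 3"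
        using s0 y0 y3 by (simp add: power_divide field_simps)
      have 2: "(1 / s) ^ 3 + 1 = (1 + s ^ 3) / s ^ 3"
        using s0 by (simp add: power_divide field_simps)
      define t where "t = s ^ 3 - 2"
      have t: "t \<noteq> 0" "2 - s ^ 3 = - t" using s3 by (auto simp: t_def)
      have "1 / \<psi> u = 1 / (- s / y) * ((1 + s ^ 3) / s ^ 3) / (t / s ^ 3)"
        unfolding dup t(2) using s0 t(1) by simp
      then show ?thesis
        unfolding neg s_def[symmetric] 1 2 t_def .
    qed
  qed
qed

text \<open>
  The pole at \<open>0\<close> is the flex at infinity taken as origin; it serves to see that \<open>P\<close> is not constant.  The equation
  holds near \<open>0\<close> by construction, and on the whole plane by the identity theorem.
\<close>
lemma fermat_cubic_meromorphic_parametrization: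
  obtains P where "P meromorphic_on UNIV" "is_pole P 0"
    "\<And>u. \<forall>\<^sub>F w in at u. P w ^ 3 + P (- w) ^ 3 = 1"
proof -
  obtain \<psi> r where \<psi>: "r > 0" "\<psi> holomorphic_on ball 0 r" "\<psi> 0 = 0"
    "\<And>u. u \<in> ball 0 r - {0} \<Longrightarrow> \<psi> u \<noteq> 0"
    "\<And>u. u \<in> ball 0 r - {0} \<Longrightarrow> (1 / \<psi> u) ^ 3 + (1 / \<psi> (- u)) ^ 3 = 1"
    "\<And>u. u \<in> ball 0 r - {0} \<Longrightarrow> 1 / \<psi> u =
       (1 / \<psi> (- u / 2)) * ((1 / \<psi> (u / 2)) ^ 3 + 1) / ((1 / \<psi> (- u / 2)) ^ 3 - (1 / \<psi> (u / 2)) ^ 3)"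
    by (rule fermat_cubic_local_parametrization) blast
  define P0 where "P0 = (\<lambda>u. 1 / \<psi> u)"
  have "\<psi> analytic_on ball 0 r" using \<psi>(2) by (simp add: analytic_on_open)
  then have merP0: "P0 meromorphic_on ball 0 r"
    unfolding P0_def by (intro meromorphic_intros analytic_on_imp_meromorphic_on)
  obtain P where P: "P meromorphic_on UNIV" "\<And>u. u \<in> ball 0 r \<Longrightarrow> \<forall>\<^sub>F w in at u. P w = P0 w"
  proof (rule meromorphic_doubling_extension[OF \<psi>(1) merP0, of "\<lambda>x y. y * (x ^ 3 + 1) / (y ^ 3 - x ^ 3)"])
    show "(\<lambda>w. g w * (f w ^ 3 + 1) / (g w ^ 3 - f w ^ 3)) meromorphic_on A"
      if "f meromorphic_on A" "g meromorphic_on A" for f g A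
      using that by (intro meromorphic_intros)
    show "P0 u = P0 (- u / 2) * (P0 (u / 2) ^ 3 + 1) / (P0 (- u / 2) ^ 3 - P0 (u / 2) ^ 3)"
      if "u \<in> ball 0 r - {0}" for u
      unfolding P0_def using \<psi>(6)[OF that] .
  qed blast
  have near: "\<forall>\<^sub>F w in at 0. w \<in> ball 0 r - {0}"
    using \<psi>(1) by (intro eventually_at_in_open) auto
  have P0_ev: "\<forall>\<^sub>F w in at 0. P w = P0 w" using P(2)[of 0] \<psi>(1) by simp
  have "is_pole P0 0"
    unfolding is_pole_def P0_def
  proof (rule filterlim_divide_at_infinity[OF tendsto_const])
    have "isCont \<psi> 0"
      using \<psi>(1,2) by (meson centre_in_ball holomorphic_on_imp_continuous_on continuous_on_eq_continuous_at open_ball)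
    then have "(\<psi> \<longlongrightarrow> 0) (at 0)" by (simp add: isCont_def \<psi>(3))
    moreover have "\<forall>\<^sub>F w in at 0. \<psi> w \<noteq> 0" using near by eventually_elim (use \<psi>(4) in auto)
    ultimately show "filterlim \<psi> (at 0) (at 0)" by (simp add: filterlim_at)
  qed simp
  then have pole: "is_pole P 0" using is_pole_cong[OF P0_ev refl] by simp
  define Q where "Q = (\<lambda>w. P w ^ 3 + P (- w) ^ 3)"
  have merQ: "Q meromorphic_on UNIV"
    unfolding Q_def
    by (intro meromorphic_intros P meromorphic_on_compose[OF P(1)]) (auto intro!: analytic_intros)
  have lim: "filterlim uminus (at 0) (at (0::complex))"
    by (auto simp: filterlim_at eventually_at_filter intro!: tendsto_eq_intros)
  have "\<forall>\<^sub>F w in at 0. remove_sings Q w = Q w"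
    by (rule eventually_remove_sings_eq_at meromorphic_on_isolated_singularity meromorphic_on_subset[OF merQ] subset_UNIV)+
  from this near P0_ev eventually_compose_filterlim[OF P0_ev lim]
  have "\<forall>\<^sub>F w in at 0. remove_sings Q w = 1"
    by eventually_elim (use \<psi>(5) in \<open>auto simp: Q_def P0_def\<close>)
  then have "\<exists>\<^sub>F w in at 0. remove_sings Q w = 1"
    by (intro eventually_frequently) auto
  then have Q1: "remove_sings Q w = 1" for w
    using frequently_eq_meromorphic_imp_constant[of "remove_sings Q" 1 0 UNIV w]
      remove_sings_nicely_meromorphic[OF merQ] by auto
  have "\<forall>\<^sub>F w in at u. Q w = 1" for u
    using eventually_remove_sings_eq_at[OF meromorphic_on_isolated_singularity[OF meromorphic_on_subset[OF merQ subset_UNIV]], of u]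
    unfolding Q1 by (auto elim: eventually_mono)
  then show ?thesis
    by (intro that[OF P(1) pole]) (simp add: Q_def)
qed

section \<open>The equation with a shift\<close>

lemma eventually_at_shift:
  fixes c :: complex
  assumes "\<forall>\<^sub>F w in at (z + c). Q w"
  shows "\<forall>\<^sub>F w in at z. Q (w + c)"
  using assms by (subst (asm) at_to_0) (auto simp: eventually_filtermap at_to_0[of z] add_ac)

text \<open>
  The exponential \<open>h(z) = exp (\<pi> \<i> z / c)\<close> satisfies \<open>h(z + c) = - h(z)\<close>, so \<open>P \<circ> h\<close> turns the symmetry between \<open>P(u)\<close>
  and \<open>P(- u)\<close> into the shift.
\<close>
lemma fermat_shift_solution_cubic_exists:
  assumes "c \<noteq> 0"
  shows "\<exists>f. fermat_shift_solution 3 3 c f \<and> \<not> f constant_on UNIV"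
proof -
  obtain P where P: "P meromorphic_on UNIV" "is_pole P 0"
    "\<And>u. \<forall>\<^sub>F w in at u. P w ^ 3 + P (- w) ^ 3 = 1"
    by (rule fermat_cubic_meromorphic_parametrization) blast
  define h where "h = (\<lambda>z. exp (of_real pi * \<i> * z / c))"
  have hol: "h holomorphic_on UNIV" unfolding h_def by (intro holomorphic_intros) (use assms in auto)
  have h_shift: "h (z + c) = - h z" for z
    using assms by (simp add: h_def add_divide_distrib distrib_left exp_add)
  have lim: "filterlim h (at (h z)) (at z)" for z
  proof -
    have "(h has_field_derivative of_real pi * \<i> / c * h z) (at z)"
      unfolding h_def using assms by (auto intro!: derivative_eq_intros)
    then have "deriv h z \<noteq> 0" using assms by (auto simp: DERIV_imp_deriv h_def)
    then obtain r where r: "r > 0" "inj_on h (ball z r)"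
      by (rule has_complex_derivative_locally_injective[OF hol UNIV_I open_UNIV])
    have "\<forall>\<^sub>F w in at z. w \<in> ball z r - {z}"
      using r(1) by (intro eventually_at_in_open) auto
    then have "\<forall>\<^sub>F w in at z. h w \<noteq> h z"
      by eventually_elim (use r in \<open>auto dest: inj_onD\<close>)
    moreover have "isCont h z"
      using hol by (meson UNIV_I holomorphic_on_imp_continuous_on continuous_on_eq_continuous_at open_UNIV)
    ultimately show ?thesis by (simp add: filterlim_at isCont_def)
  qed
  define F where "F = (\<lambda>z. P (h z))"
  have merF: "F meromorphic_on UNIV"
    unfolding F_def using hol by (intro meromorphic_on_compose[OF P(1)]) (auto simp: analytic_on_open)
  define f where "f = remove_sings F"
  have nf: "f nicely_meromorphic_on UNIV" unfolding f_def using merF by (rule remove_sings_nicely_meromorphic)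
  have fF: "\<forall>\<^sub>F w in at z. f w = F w" for z
    unfolding f_def
    by (rule eventually_remove_sings_eq_at meromorphic_on_isolated_singularity meromorphic_on_subset[OF merF] subset_UNIV)+
  have "f z ^ 3 + f (z + c) ^ 3 = 1" if "\<not> is_pole f z" "\<not> is_pole f (z + c)" for z
  proof -
    have cont: "isCont f w" if "\<not> is_pole f w" for w
      using nicely_meromorphic_on_imp_analytic_at[OF nf UNIV_I that] by (rule analytic_at_imp_isCont)
    have "isCont (\<lambda>w. f (w + c)) z"
      using isCont_o2[of z "\<lambda>w. w + c" f] cont[OF that(2)] by simp
    then have "((\<lambda>w. f w ^ 3 + f (w + c) ^ 3) \<longlongrightarrow> f z ^ 3 + f (z + c) ^ 3) (at z)"
      using cont[OF that(1)] by (intro tendsto_intros) (auto simp: isCont_def)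
    moreover have "\<forall>\<^sub>F w in at z. f w ^ 3 + f (w + c) ^ 3 = 1"
      using fF[of z] eventually_at_shift[OF fF[of "z + c"]] eventually_compose_filterlim[OF P(3) lim[of z]]
      by eventually_elim (simp add: F_def h_shift)
    ultimately show ?thesis
      using tendsto_unique[of "at z" "\<lambda>w. f w ^ 3 + f (w + c) ^ 3" "f z ^ 3 + f (z + c) ^ 3" 1]
      by (auto intro: tendsto_eventually)
  qed
  with nf have sol: "fermat_shift_solution 3 3 c f" by (simp add: fermat_shift_solution_def)
  have "\<not> f constant_on UNIV"
  proof
    assume "f constant_on UNIV"
    then obtain \<kappa> where \<kappa>: "\<And>z. f z = \<kappa>" by (auto simp: constant_on_def)
    have ev: "\<forall>\<^sub>F w in at u. remove_sings P w = P w" for u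
      by (rule eventually_remove_sings_eq_at meromorphic_on_isolated_singularity meromorphic_on_subset[OF P(1)] subset_UNIV)+
    \<comment> \<open>a constant \<open>P \<circ> h\<close> would make \<open>P\<close> constant near \<open>h 0\<close>, hence everywhere, against its pole at \<open>0\<close>\<close>
    have "\<exists>\<^sub>F v in at (h 0). remove_sings P v = \<kappa>"
      unfolding frequently_def
    proof
      assume "\<forall>\<^sub>F v in at (h 0). remove_sings P v \<noteq> \<kappa>"
      from eventually_compose_filterlim[OF this lim] eventually_compose_filterlim[OF ev lim] fF[of 0]
      have "\<forall>\<^sub>F w in at (0::complex). False"
        by eventually_elim (use \<kappa> in \<open>auto simp: F_def\<close>)
      then show False by simp
    qed
    then have const: "remove_sings P w = \<kappa>" for w
      using frequently_eq_meromorphic_imp_constant[of "remove_sings P" \<kappa> "h 0" UNIV w]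
        remove_sings_nicely_meromorphic[OF P(1)] by auto
    have "(P \<longlongrightarrow> \<kappa>) (at 0)"
      using ev[of 0] unfolding const by (intro tendsto_eventually) (auto elim: eventually_mono)
    with P(2) show False
      unfolding is_pole_def using not_tendsto_and_filterlim_at_infinity[of "at 0" P \<kappa>] by auto
  qed
  with sol show ?thesis by blast
qed

lemma is_pole_power:
  fixes f :: "complex \<Rightarrow> complex"
  assumes "is_pole f z" "n > 0"
  shows "is_pole (\<lambda>z. f z ^ n) z"
  using assms(2)
proof (induction n rule: nat_induct_non_zero)
  case (Suc n)
  then show ?case using assms(1) filterlim_at_infinity_times[of f "at z" "\<lambda>z. f z ^ n"]
    by (simp add: is_pole_def)
qed (use assms in simp)

text \<open>
  A power of \<open>f\<close> that tends to infinity can only be compensated by a power of \<open>g\<close> of the same order.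
\<close>
lemma fermat_equation_poles:
  fixes f g :: "complex \<Rightarrow> complex"
  assumes mer: "f meromorphic_on {z}" "g meromorphic_on {z}"
    and nm: "n > 0" "m > 0" and eq: "\<forall>\<^sub>F w in at z. f w ^ n + g w ^ m = 1"
    and pole: "is_pole f z"
  shows "is_pole g z \<and> int n * zorder f z = int m * zorder g z"
proof
  have ev: "\<forall>\<^sub>F w in at z. f w ^ n = 1 - g w ^ m"
    using eq by eventually_elim (simp add: eq_diff_eq)
  show pg: "is_pole g z"
  proof (rule ccontr)
    assume "\<not> is_pole g z"
    then obtain l where "(g \<longlongrightarrow> l) (at z)"
      using meromorphic_on_not_essential[OF mer(2)] by (auto simp: not_essential_def)
    then have "((\<lambda>w. 1 - g w ^ m) \<longlongrightarrow> 1 - l ^ m) (at z)" by (intro tendsto_intros)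
    then have "((\<lambda>w. f w ^ n) \<longlongrightarrow> 1 - l ^ m) (at z)" using tendsto_cong[OF ev] by simp
    moreover have "filterlim (\<lambda>w. f w ^ n) at_infinity (at z)"
      using is_pole_power[OF pole nm(1)] by (simp add: is_pole_def)
    ultimately show False using not_tendsto_and_filterlim_at_infinity[of "at z"] by auto
  qed
  have freq: "\<exists>\<^sub>F w in at z. k w \<noteq> 0" if "is_pole k z" for k :: "complex \<Rightarrow> complex"
    using that unfolding is_pole_def
    by (intro eventually_frequently filterlim_at_infinity_imp_eventually_ne) auto
  have merg: "(\<lambda>w. g w ^ m) meromorphic_on {z}" using mer by (intro meromorphic_intros)
  have pgm: "is_pole (\<lambda>w. g w ^ m) z" using pg nm by (intro is_pole_power)
  then have "zorder (\<lambda>w. g w ^ m) z < 0"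
    by (intro isolated_pole_imp_neg_zorder meromorphic_on_isolated_singularity merg)
  then have "zorder (\<lambda>w. 1 - g w ^ m) z = zorder (\<lambda>w. g w ^ m) z"
    using merg freq[OF pgm] by (intro zorder_diff2) (auto intro: eventually_frequently)
  moreover have "zorder (\<lambda>w. f w ^ n) z = zorder (\<lambda>w. 1 - g w ^ m) z"
    using ev by (intro zorder_cong refl)
  moreover have "zorder (\<lambda>w. f w ^ n) z = int n * zorder f z" "zorder (\<lambda>w. g w ^ m) z = int m * zorder g z"
    using mer freq[OF pole] freq[OF pg] by (simp_all add: zorder_power)
  ultimately show "int n * zorder f z = int m * zorder g z" by simp
qed

text \<open>
  The pole order decreases strictly from \<open>z\<close> to \<open>z + c\<close> if \<open>n < m\<close> and from \<open>z\<close> to \<open>z - c\<close> if \<open>n > m\<close>, which cannot go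
  on for ever.
\<close>
lemma unequal_exponents_no_poles:
  assumes sol: "\<And>z. is_pole f z \<longleftrightarrow> is_pole f (z + c)"
    and ord: "\<And>z. is_pole f z \<Longrightarrow> int n * zorder f z = int m * zorder f (z + c)"
    and neg: "\<And>z. is_pole f z \<Longrightarrow> zorder f z < 0"
    and "n \<noteq> m" "n > 0" "m > 0"
  shows "\<not> is_pole f z"
proof (induction "nat (- zorder f z)" arbitrary: z rule: less_induct)
  case less
  show ?case
  proof
    assume p: "is_pole f z"
    consider "n < m" | "m < n" using \<open>n \<noteq> m\<close> by linarith
    then show False
    proof cases
      case 1
      have p': "is_pole f (z + c)" using p sol by blast
      have "int m * (- zorder f (z + c)) = int n * (- zorder f z)" using ord[OF p] by simp
      also have "\<dots> < int m * (- zorder f z)" using neg[OF p] 1 by (intro mult_strict_right_mono) auto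
      finally have "- zorder f (z + c) < - zorder f z" using \<open>m > 0\<close> by (simp add: mult_less_cancel_left)
      then show False using less[of "z + c"] p' neg[OF p] by auto
    next
      case 2
      have p': "is_pole f (z - c)" using p sol[of "z - c"] by simp
      have "int n * (- zorder f (z - c)) = int m * (- zorder f z)" using ord[OF p'] by simp
      also have "\<dots> < int n * (- zorder f z)" using neg[OF p] 2 by (intro mult_strict_right_mono) auto
      finally have "- zorder f (z - c) < - zorder f z" using \<open>n > 0\<close> by (simp add: mult_less_cancel_left)
      then show False using less[of "z - c"] p' neg[OF p] by auto
    qed
  qed
qed

lemma fermat_shift_solution_equation:
  assumes "fermat_shift_solution n m c f"
  shows "f meromorphic_on A" "(\<lambda>z. f (z + c)) meromorphic_on A"
    and "\<forall>\<^sub>F w in at z. f w ^ n + f (w + c) ^ m = 1"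
proof -
  have nf: "f nicely_meromorphic_on UNIV" using assms by (simp add: fermat_shift_solution_def)
  then have mf: "f meromorphic_on UNIV" by (simp add: nicely_meromorphic_on_def)
  then show "f meromorphic_on A" by (rule meromorphic_on_subset) simp
  show "(\<lambda>z. f (z + c)) meromorphic_on A"
    by (rule meromorphic_on_compose[OF mf]) (auto intro!: analytic_intros)
  have np: "\<forall>\<^sub>F w in at z. \<not> is_pole f w" for z
    using meromorphic_on_imp_not_pole_cosparse[OF mf] by (rule eventually_cosparse_imp_eventually_at) simp
  show "\<forall>\<^sub>F w in at z. f w ^ n + f (w + c) ^ m = 1"
    using np[of z] eventually_at_shift[OF np[of "z + c"]]
    by eventually_elim (use assms in \<open>auto simp: fermat_shift_solution_def\<close>)
qed

lemma fermat_shift_solution_unequal_exponents: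
  assumes sol: "fermat_shift_solution n m c f" and nm: "n \<noteq> m" "n \<ge> 2" "m \<ge> 2" "m + n \<ge> 5"
  shows "f constant_on UNIV"
proof -
  note eqn = fermat_shift_solution_equation[OF sol]
  have nf: "f nicely_meromorphic_on UNIV" using sol by (simp add: fermat_shift_solution_def)
  have shift: "is_pole (\<lambda>z. f (z + c)) z \<longleftrightarrow> is_pole f (z + c)"
              "zorder (\<lambda>z. f (z + c)) z = zorder f (z + c)" for z
    using is_pole_shift_iff[of f c z] zorder_shift[of "\<lambda>z. f (z + c)" z] zorder_shift[of f "z + c"]
    by (simp_all add: o_def add_ac)
  have fwd: "is_pole f (z + c) \<and> int n * zorder f z = int m * zorder f (z + c)" if "is_pole f z" for z
    using fermat_equation_poles[OF eqn(1,2) _ _ eqn(3) that] nm shift by auto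
  have bwd: "is_pole f z" if "is_pole f (z + c)" for z
  proof -
    have "\<forall>\<^sub>F w in at z. f (w + c) ^ m + f w ^ n = 1"
      using eqn(3)[of z] by (simp add: add.commute)
    then show ?thesis
      using fermat_equation_poles[where z = z and n = m and m = n, OF eqn(2,1)] that nm shift(1) by auto
  qed
  have "\<not> is_pole f z" for z
  proof (rule unequal_exponents_no_poles)
    show "zorder f z < 0" if "is_pole f z" for z
      using that meromorphic_on_isolated_singularity[OF eqn(1)] by (intro isolated_pole_imp_neg_zorder)
  qed (use fwd bwd nm in auto)
  then have hf: "f holomorphic_on UNIV"
    using nicely_meromorphic_without_singularities[OF nf] by (simp add: analytic_imp_holomorphic)
  then have hg: "(\<lambda>z. f (z + c)) holomorphic_on UNIV"
    using holomorphic_on_compose[of "\<lambda>z. z + c" UNIV f] holomorphic_on_subset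
    by (auto simp: o_def holomorphic_on_add)
  have eq: "f z ^ n + f (z + c) ^ m = 1" for z
    using sol \<open>\<And>z. \<not> is_pole f z\<close> by (simp add: fermat_shift_solution_def)
  show ?thesis
  proof (cases "m \<ge> 3")
    case True
    then have "(\<lambda>z. f (z + c)) constant_on UNIV"
      by (rule entire_fermat_equation_trivial[OF hf hg nm(2) _ eq])
    then obtain k where "\<And>z. f (z + c) = k" by (auto simp: constant_on_def)
    then have "f z = k" for z by (metis diff_add_cancel)
    then show ?thesis by (auto simp: constant_on_def)
  next
    case False
    then have "n \<ge> 3" using nm by simp
    then show ?thesis
      by (rule entire_fermat_equation_trivial[OF hg hf nm(3)]) (use eq in \<open>simp add: add.commute\<close>)
  qed
qed

text \<open>
  Write \<open>f = X / f2\<close> with entire \<open>X, f2\<close> without common zeros.  The function \<open>Y = f2 g\<close> is entire as well, since its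
  \<open>n\<close>-th power agrees with \<open>f2^n - X^n\<close>; thus \<open>f\<close> and \<open>g\<close> share the denominator \<open>f2\<close>, and the vanishing of the Wronskian
  of \<open>X\<close> and \<open>f2\<close> says that \<open>f' = 0\<close>.
\<close>
lemma meromorphic_fermat_equation_trivial:
  assumes nf: "f nicely_meromorphic_on UNIV" and mg: "g meromorphic_on UNIV" and n: "n \<ge> 4"
    and eq: "\<And>z. \<forall>\<^sub>F w in at z. f w ^ n + g w ^ n = 1"
  shows "f constant_on UNIV"
proof -
  obtain h f1 f2 where w: "h holomorphic_on UNIV" "f1 holomorphic_on UNIV" "f2 holomorphic_on UNIV"
    "\<forall>z. f1 z = 0 \<longleftrightarrow> \<not> is_pole f z \<and> f z = 0" "\<forall>z. f2 z = 0 \<longleftrightarrow> is_pole f z"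
    "\<forall>z. h z \<noteq> 0" "\<forall>z. f z = h z * f1 z / f2 z"
    by (rule weierstrass_factorization_meromorphic_UNIV[OF nf]) blast
  define X where "X = (\<lambda>z. h z * f1 z)"
  have hol: "X holomorphic_on UNIV" "f2 holomorphic_on UNIV"
    unfolding X_def by (intro holomorphic_intros w)+
  have fX: "f z = X z / f2 z" for z using w(7) by (simp add: X_def)
  have coprime: "X z \<noteq> 0 \<or> f2 z \<noteq> 0" for z using w(4,5,6) by (auto simp: X_def)
  have mf: "f meromorphic_on UNIV" using nf by (simp add: nicely_meromorphic_on_def)
  have np: "\<forall>\<^sub>F w in at z. f2 w \<noteq> 0" for z
    using eventually_cosparse_imp_eventually_at[OF meromorphic_on_imp_not_pole_cosparse[OF mf] UNIV_I, of z UNIV] w(5)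
    by simp
  define Y0 where "Y0 = (\<lambda>z. f2 z * g z)"
  have merY0: "Y0 meromorphic_on A" for A
    unfolding Y0_def using w(3)
    by (intro meromorphic_on_mult analytic_on_imp_meromorphic_on meromorphic_on_subset[OF mg])
       (auto simp: analytic_on_open intro: analytic_on_subset[of _ UNIV])
  have Y0_eq: "\<forall>\<^sub>F w in at z. Y0 w ^ n = f2 w ^ n - X w ^ n" for z
    using eq[of z] np[of z]
    by eventually_elim (simp add: Y0_def fX power_mult_distrib power_divide field_simps)
  have cont: "isCont k z" if "k holomorphic_on UNIV" for k :: "complex \<Rightarrow> complex" and z
    using that by (meson UNIV_I holomorphic_on_imp_continuous_on continuous_on_eq_continuous_at open_UNIV)
  have lim: "((\<lambda>w. f2 w ^ n - X w ^ n) \<longlongrightarrow> f2 z ^ n - X z ^ n) (at z)" for z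
    using cont[OF hol(1), of z] cont[OF hol(2), of z] by (intro tendsto_intros) (auto simp: isCont_def)
  define Y where "Y = remove_sings Y0"
  have anY: "Y analytic_on {z}" for z
  proof -
    have "\<not> is_pole Y0 z"
    proof
      assume "is_pole Y0 z"
      then have "filterlim (\<lambda>w. Y0 w ^ n) at_infinity (at z)"
        using is_pole_power[of Y0 z n] n by (simp add: is_pole_def)
      moreover have "((\<lambda>w. Y0 w ^ n) \<longlongrightarrow> f2 z ^ n - X z ^ n) (at z)"
        using lim[of z] tendsto_cong[OF Y0_eq[of z]] by simp
      ultimately show False using not_tendsto_and_filterlim_at_infinity[of "at z"] by auto
    qed
    then obtain l where "(Y0 \<longlongrightarrow> l) (at z)"
      using meromorphic_on_not_essential[OF merY0] by (auto simp: not_essential_def)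
    then show ?thesis
      unfolding Y_def by (intro remove_sings_analytic_at meromorphic_on_isolated_singularity merY0)
  qed
  then have holY: "Y holomorphic_on UNIV"
    using analytic_on_analytic_at analytic_imp_holomorphic by blast
  have XYZ: "X z ^ n + Y z ^ n = f2 z ^ n" for z
  proof -
    have "\<forall>\<^sub>F w in at z. Y w = Y0 w"
      unfolding Y_def by (intro eventually_remove_sings_eq_at meromorphic_on_isolated_singularity merY0)
    with Y0_eq[of z] have "\<forall>\<^sub>F w in at z. Y w ^ n = f2 w ^ n - X w ^ n"
      by eventually_elim simp
    moreover have "((\<lambda>w. Y w ^ n) \<longlongrightarrow> Y z ^ n) (at z)"
      using cont[OF holY, of z] by (intro tendsto_intros) (auto simp: isCont_def)
    ultimately have "((\<lambda>w. f2 w ^ n - X w ^ n) \<longlongrightarrow> Y z ^ n) (at z)"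
      using tendsto_cong by fastforce
    then have "Y z ^ n = f2 z ^ n - X z ^ n" using lim[of z] by (intro tendsto_unique[of "at z"]) auto
    then show ?thesis by simp
  qed
  have wronskian: "deriv X z * f2 z = X z * deriv f2 z" for z
    using coprime by (intro entire_fermat_curve_trivial[OF hol(1) holY hol(2) n XYZ]) blast
  obtain z1 where z1: "f2 z1 \<noteq> 0"
    using eventually_happens'[OF _ np[of 0]] by auto
  have "\<forall>\<^sub>F w in nhds z1. f2 w \<noteq> 0"
    using z1 cont[OF hol(2), of z1] continuous_at_avoid[of z1 f2 0]
    by (auto simp: eventually_nhds_metric dist_commute)
  then obtain r where r: "r > 0" "\<And>w. w \<in> ball z1 r \<Longrightarrow> f2 w \<noteq> 0"
    unfolding eventually_nhds_metric by (auto simp: dist_commute)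
  have "\<exists>k. \<forall>w\<in>ball z1 r. X w / f2 w = k"
  proof (rule has_field_derivative_zero_constant)
    fix w assume wb: "w \<in> ball z1 r"
    have "(X has_field_derivative deriv X w) (at w)" "(f2 has_field_derivative deriv f2 w) (at w)"
      using hol by (auto intro: holomorphic_derivI[of _ UNIV])
    from DERIV_divide[OF this r(2)[OF wb]]
    have "((\<lambda>w. X w / f2 w) has_field_derivative 0) (at w)"
      by (simp add: wronskian)
    then show "((\<lambda>w. X w / f2 w) has_field_derivative 0) (at w within ball z1 r)"
      by (rule has_field_derivative_at_within)
  qed simp
  then have "f constant_on ball z1 r" by (simp add: constant_on_def fX)
  then show ?thesis
    using r(1) by (intro constant_on_extend_nicely_meromorphic_on[OF nf]) auto
qed

theorem corollary2:
  fixes c :: complex and n m :: nat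
  assumes "c \<noteq> 0" and "n \<ge> 2" and "m \<ge> 2" and "m + n \<ge> 5"
  shows "(\<exists>f. fermat_shift_solution n m c f \<and> \<not> f constant_on UNIV) \<longleftrightarrow> n = 3 \<and> m = 3"
proof
  assume "n = 3 \<and> m = 3"
  then show "\<exists>f. fermat_shift_solution n m c f \<and> \<not> f constant_on UNIV"
    using fermat_shift_solution_cubic_exists[OF assms(1)] by simp
next
  assume "\<exists>f. fermat_shift_solution n m c f \<and> \<not> f constant_on UNIV"
  then obtain f where sol: "fermat_shift_solution n m c f" and nc: "\<not> f constant_on UNIV" by blast
  have "n = m" using fermat_shift_solution_unequal_exponents[OF sol] assms nc by blast
  moreover have "\<not> n \<ge> 4"
  proof
    assume "n \<ge> 4"
    moreover have "f nicely_meromorphic_on UNIV" using sol by (simp add: fermat_shift_solution_def)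
    ultimately have "f constant_on UNIV"
      using fermat_shift_solution_equation[OF sol] \<open>n = m\<close>
      by (intro meromorphic_fermat_equation_trivial[of f "\<lambda>z. f (z + c)" n]) auto
    with nc show False by contradiction
  qed
  ultimately show "n = 3 \<and> m = 3" using assms by linarith
qed

end
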